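(* Let $\mathcal A$ be a complex unital commutative Banach algebra and let $\eta\in\widehat{\mathcal A}$ be a unital continuous algebra homomorphism $\mathcal A\to\mathbb C$ with kernel $\mathcal I$ such that $T_\eta(\mathcal A)=\mathcal I/\overline{\mathcal I^2}$ is infinite dimensional. Let $G:=\widetilde{\mathrm{SL}}_2(\mathcal A)_0$ and let $\varphi_\eta^G:G\to\mathrm{SL}_2(\mathbb C)$ denote the group homomorphism induced by $\eta$. Then, for the holomorphic character $$\xi\Big(\begin{pmatrix}a&b\\0&a^{-1}\end{pmatrix}\Big):=a^{-1}$$ of $P(\mathbb C)$ and the pullback of its square $\chi:=(\varphi_\eta^G)^*(\xi^2):P(\mathcal A)\to\mathbb C^\times$, the space $\mathcal O_\chi(G)$ is infinite dimensional.
   Context: $\mathfrak{sl}_2(\mathcal A)=\mathfrak{sl}_2(\mathbb C)\otimes\mathcal A$ is the Banach--Lie algebra of trace-zero $2\times2$ matrices over $\mathcal A$; $\widetilde{\mathrm{SL}}_2(\mathcal A)_0$ is the simply connected covering group of the identity component $\mathrm{SL}_2(\mathcal A)_0$ of $\mathrm{SL}_2(\mathcal A)$. $P(\mathcal A)\subseteq G$ is the connected Lie subgroup whose Lie algebra consists of the upper triangular matrices in $\mathfrak{sl}_2(\mathcal A)$, and $P(\mathbb C)\subseteq\mathrm{SL}_2(\mathbb C)$ is the subgroup of upper triangular matrices. $\overline{\mathcal I^2}$ is the closure of the span of products of two elements of $\mathcal I$. $\varphi_\eta^G$ is the homomorphism of Banach--Lie groups integrating $\mathfrak{sl}_2(\mathcal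 A)\to\mathfrak{sl}_2(\mathbb C)$, $x\otimes a\mapsto\eta(a)x$ (i.e. entrywise application of $\eta$ after projecting to $\mathrm{SL}_2(\mathcal A)$); it maps $P(\mathcal A)$ into $P(\mathbb C)$, and $(\varphi_\eta^G)^*(\xi^2)=\xi^2\circ\varphi_\eta^G|_{P(\mathcal A)}$. $\mathcal O_\chi(G):=\{f:G\to\mathbb C\text{ holomorphic}: f(gp)=\chi(p)^{-1}f(g)\ \forall g\in G,\ p\in P(\mathcal A)\}$, which is the space of holomorphic sections of the homogeneous line bundle $G\times_\chi\mathbb C$ over $G/P(\mathcal A)$. (It is known to carry a natural Banach space structure, but the claim concerns only its dimension as a vector space.) *)

theory Defs
  imports
    "HOL-Analysis.Analysis"
    "HOL-Library.Function_Algebras"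
    "HOL-Algebra.Generated_Groups"
begin

section \<open>Complex unital commutative Banach algebras\<close>

text \<open>No normalisation of the norm of the unit is imposed: only the norm inequality for products
  (from \<open>real_normed_algebra\<close>) is required. The scalar multiplication \<open>scaleR\<close> of the underlying
  real Banach space has to be the restriction of \<open>scaleC\<close>.\<close>

class comm_complex_banach_algebra = real_normed_algebra + comm_ring_1 + banach +
  fixes scaleC :: "complex \<Rightarrow> 'a \<Rightarrow> 'a" (infixr "*\<^sub>C" 75)
  assumes scaleC_add_right: "c *\<^sub>C (x + y) = c *\<^sub>C x + c *\<^sub>C y"
    and scaleC_add_left: "(c + d) *\<^sub>C x = c *\<^sub>C x + d *\<^sub>C x"
    and scaleC_scaleC: "c *\<^sub>C d *\<^sub>C x = (c * d) *\<^sub>C x"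
    and scaleC_one: "1 *\<^sub>C x = x"
    and scaleC_mult_left: "(c *\<^sub>C x) * y = c *\<^sub>C (x * y)"
    and scaleC_of_real: "complex_of_real r *\<^sub>C x = r *\<^sub>R x"
    and norm_scaleC: "norm (c *\<^sub>C x) = cmod c * norm x"

global_interpretation complex_space:
  vector_space "scaleC :: complex \<Rightarrow> 'a \<Rightarrow> 'a::comm_complex_banach_algebra"
  defines cspan = complex_space.span
  by unfold_locales (simp_all add: scaleC_add_right scaleC_add_left scaleC_scaleC scaleC_one)

global_interpretation complex_functions:
  vector_space "\<lambda>(c::complex) (f::'g \<Rightarrow> complex) g. c * f g"
  defines fun_cspan = complex_functions.span
  by unfold_locales (auto simp: fun_eq_iff algebra_simps)

definition banach_character :: "('a::comm_complex_banach_algebra \<Rightarrow> complex) \<Rightarrow> bool" where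
  "banach_character \<eta> \<longleftrightarrow>
     (\<forall>x y. \<eta> (x + y) = \<eta> x + \<eta> y) \<and> (\<forall>c x. \<eta> (c *\<^sub>C x) = c * \<eta> x) \<and>
     (\<forall>x y. \<eta> (x * y) = \<eta> x * \<eta> y) \<and> \<eta> 1 = 1 \<and> continuous_on UNIV \<eta>"

definition character_kernel :: "('a::comm_complex_banach_algebra \<Rightarrow> complex) \<Rightarrow> 'a set" where
  "character_kernel \<eta> = {x. \<eta> x = 0}"

definition closed_square :: "'a::comm_complex_banach_algebra set \<Rightarrow> 'a set" where
  "closed_square I = closure (cspan {x * y | x y. x \<in> I \<and> y \<in> I})"

definition additive_coset :: "'a::ab_group_add set \<Rightarrow> 'a \<Rightarrow> 'a set" where
  "additive_coset W v = (\<lambda>w. v + w) ` W"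

definition quotient_space :: "'a::ab_group_add set \<Rightarrow> 'a set \<Rightarrow> 'a set set" where
  "quotient_space V W = additive_coset W ` V"

text \<open>The cosets of the elements of \<open>B\<close> span \<open>V / W\<close>: the linear combinations of these cosets
  are the cosets of the linear combinations of elements of \<open>B\<close>.\<close>

definition finite_dim_quotient :: "'a::comm_complex_banach_algebra set \<Rightarrow> 'a set \<Rightarrow> bool" where
  "finite_dim_quotient V W \<longleftrightarrow>
     (\<exists>B. finite B \<and> B \<subseteq> V \<and> quotient_space V W \<subseteq> additive_coset W ` cspan B)"

definition finite_dim_function_space :: "('g \<Rightarrow> complex) set \<Rightarrow> bool" where
  "finite_dim_function_space V \<longleftrightarrow> (\<exists>B. finite B \<and> B \<subseteq> V \<and> V \<subseteq> fun_cspan B)"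

section \<open>The group \<open>SL\<^sub>2\<close> over the algebra and its Lie algebra\<close>

text \<open>Matrices have type \<open>'a^2^2\<close>, with the product \<open>**\<close> and the Banach space norm of that type
  (which induces the product topology on the entries).\<close>

definition SL2 :: "('a::comm_complex_banach_algebra^2^2) set" where
  "SL2 = {M. det M = 1}"

definition SL2_0 :: "('a::comm_complex_banach_algebra^2^2) set" where
  "SL2_0 = connected_component_set SL2 (mat 1)"

definition sl2 :: "('a::comm_complex_banach_algebra^2^2) set" where
  "sl2 = {X. trace X = 0}"

definition upper_sl2 :: "('a::comm_complex_banach_algebra^2^2) set" where
  "upper_sl2 = {X \<in> sl2. X $ 2 $ 1 = 0}"

definition matrix_scaleC :: "complex \<Rightarrow> 'a::comm_complex_banach_algebra^2^2 \<Rightarrow> 'a^2^2" where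
  "matrix_scaleC c X = (\<chi> i j. c *\<^sub>C (X $ i $ j))"

definition matrix_exp :: "'a::comm_complex_banach_algebra^2^2 \<Rightarrow> 'a^2^2" where
  "matrix_exp X = (\<Sum>n. (1 / fact n) *\<^sub>R (((**) X) ^^ n) (mat 1))"

section \<open>The simply connected covering group\<close>

text \<open>A simply connected covering group of a matrix group \<open>S\<close>, with covering homomorphism \<open>q\<close>.
  It is unique up to isomorphism; the group occupies the whole type \<open>'g\<close>, whose topology
  is the one of the type class. (\<open>simply_connected\<close> includes path-connectedness.)\<close>

definition simply_connected_covering_group ::
  "'g::topological_space monoid \<Rightarrow> ('g \<Rightarrow> 'a::comm_complex_banach_algebra^2^2) \<Rightarrow>
   ('a^2^2) set \<Rightarrow> bool" where
  "simply_connected_covering_group G q S \<longleftrightarrow>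
     group G \<and> carrier G = UNIV \<and>
     continuous_on UNIV (\<lambda>(x, y). x \<otimes>\<^bsub>G\<^esub> y) \<and> continuous_on UNIV (\<lambda>x. inv\<^bsub>G\<^esub> x) \<and>
     simply_connected (UNIV :: 'g set) \<and>
     covering_space UNIV q S \<and> (\<forall>x y. q (x \<otimes>\<^bsub>G\<^esub> y) = q x ** q y)"

text \<open>The exponential map of the covering group: the end point of the lift, starting at the
  neutral element, of the path \<open>t \<mapsto> exp (t X)\<close>.\<close>

definition cover_exp ::
  "'g::topological_space monoid \<Rightarrow> ('g \<Rightarrow> 'a::comm_complex_banach_algebra^2^2) \<Rightarrow> 'a^2^2 \<Rightarrow> 'g" where
  "cover_exp G q X = (THE g. \<exists>\<gamma>. path \<gamma> \<and> pathstart \<gamma> = \<one>\<^bsub>G\<^esub> \<and> pathfinish \<gamma> = g \<and>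
     (\<forall>t\<in>{0..1}. q (\<gamma> t) = matrix_exp (t *\<^sub>R X)))"

text \<open>A connected Lie subgroup is generated by the exponentials of its Lie algebra.\<close>

definition parabolic ::
  "'g::topological_space monoid \<Rightarrow> ('g \<Rightarrow> 'a::comm_complex_banach_algebra^2^2) \<Rightarrow> 'g set" where
  "parabolic G q = generate G (cover_exp G q ` upper_sl2)"

definition phi_G ::
  "('a::comm_complex_banach_algebra \<Rightarrow> complex) \<Rightarrow> ('g \<Rightarrow> 'a^2^2) \<Rightarrow> 'g \<Rightarrow> complex^2^2" where
  "phi_G \<eta> q g = (\<chi> i j. \<eta> (q g $ i $ j))"

text \<open>The character of \<open>P(\<complex>)\<close> sending a matrix with diagonal \<open>(a, 1/a)\<close> to \<open>1/a\<close>. It is only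
  meaningful (and only used) on upper triangular matrices of determinant one.\<close>

definition xi :: "complex^2^2 \<Rightarrow> complex" where
  "xi M = inverse (M $ 1 $ 1)"

definition pullback_xi_squared ::
  "('a::comm_complex_banach_algebra \<Rightarrow> complex) \<Rightarrow> ('g \<Rightarrow> 'a^2^2) \<Rightarrow> 'g \<Rightarrow> complex" where
  "pullback_xi_squared \<eta> q p = (xi (phi_G \<eta> q p))\<^sup>2"

section \<open>Holomorphic functions and sections\<close>

text \<open>Complex Frechet differentiability at \<open>X\<close> of a function on (an open subset of) the complex
  Banach space \<open>sl2\<close>. The values of \<open>D\<close> outside the subspace \<open>sl2\<close> are irrelevant.\<close>

definition complex_differentiable_sl2 ::
  "('a::comm_complex_banach_algebra^2^2 \<Rightarrow> complex) \<Rightarrow> 'a^2^2 \<Rightarrow> bool" where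
  "complex_differentiable_sl2 F X \<longleftrightarrow>
     (\<exists>D. (F has_derivative D) (at X within sl2) \<and>
          (\<forall>c. \<forall>Y\<in>sl2. D (matrix_scaleC c Y) = c * D Y))"

text \<open>The complex structure of the Banach-Lie group \<open>G\<close> is the one given by the exponential
  charts \<open>X \<mapsto> g exp X\<close> around its points \<open>g\<close>.\<close>

definition holomorphic_on_group ::
  "'g::topological_space monoid \<Rightarrow> ('g \<Rightarrow> 'a::comm_complex_banach_algebra^2^2) \<Rightarrow>
   ('g \<Rightarrow> complex) \<Rightarrow> bool" where
  "holomorphic_on_group G q f \<longleftrightarrow>
     (\<forall>g\<in>carrier G. \<exists>\<epsilon>>0. \<forall>X \<in> sl2 \<inter> ball 0 \<epsilon>.
        complex_differentiable_sl2 (\<lambda>X. f (g \<otimes>\<^bsub>G\<^esub> cover_exp G q X)) X)"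

definition holomorphic_sections ::
  "'g::topological_space monoid \<Rightarrow> ('g \<Rightarrow> 'a::comm_complex_banach_algebra^2^2) \<Rightarrow>
   ('g \<Rightarrow> complex) \<Rightarrow> ('g \<Rightarrow> complex) set" where
  "holomorphic_sections G q \<kappa> =
     {f. holomorphic_on_group G q f \<and>
         (\<forall>g\<in>carrier G. \<forall>p\<in>parabolic G q. f (g \<otimes>\<^bsub>G\<^esub> p) = inverse (\<kappa> p) * f g)}"

end

theory Submission
  imports Defs
begin

text \<open>Let \<open>D\<close> be a continuous point derivation at \<open>\<eta>\<close>, i.e. \<open>D(xy) = \<eta>(x) D(y) + \<eta>(y) D(x)\<close>. If
  \<open>(x, y)\<close> is the first column of \<open>q g\<close>, put \<open>f\<^sub>D(g) = \<eta>(x) D(y) - \<eta>(y) D(x)\<close>. Multiplying \<open>g\<close> on the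
  right by \<open>p \<in> P(\<A>)\<close> with diagonal \<open>(a, 1/a)\<close> replaces \<open>(x, y)\<close> by \<open>(xa, ya)\<close>; the two terms with
  \<open>D(a)\<close> cancel and \<open>f\<^sub>D\<close> is multiplied by \<open>\<eta>(a)\<^sup>2 = \<chi>(p)\<inverse>\<close>. So \<open>f\<^sub>D\<close> is a holomorphic section, and
  its value at the exponential of the strictly lower triangular matrix with entry \<open>b\<close> is \<open>D(b)\<close>.
  By the Hahn-Banach theorem the derivations \<open>D\<close> separate the points of \<open>\<I>\<close> modulo the closure
  of \<open>\<I>\<^sup>2\<close>. If the sections \<open>f\<^sub>D\<close> spanned a finite-dimensional space, finitely many \<open>D\<close> would
  already separate them, and \<open>T\<^sub>\<eta>(\<A>)\<close> would be finite-dimensional.\<close>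

section \<open>The Hahn-Banach theorem\<close>

text \<open>Partial functionals are represented by their graphs, subspaces of \<open>'a \<times> real\<close>. Single-valuedness
  follows from the domination by the norm, so Zorn's lemma needs no separate condition for it.\<close>

lemma hahn_banach_graph:
  fixes M :: "('a::real_normed_vector \<times> real) set"
  assumes M: "subspace M" and dom: "\<And>x r. (x, r) \<in> M \<Longrightarrow> r \<le> norm x"
  shows "\<exists>u. linear u \<and> (\<forall>x. u x \<le> norm x) \<and> (\<forall>x r. (x, r) \<in> M \<longrightarrow> u x = r)"
proof -
  define A where "A = {H. subspace H \<and> M \<subseteq> H \<and> (\<forall>x r. (x, r) \<in> H \<longrightarrow> r \<le> norm x)}"
  have "\<exists>H\<in>A. \<forall>X\<in>A. H \<subseteq> X \<longrightarrow> X = H"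
  proof (rule subset_Zorn_nonempty)
    show "A \<noteq> {}" using M dom by (auto simp: A_def)
    fix C assume C: "C \<noteq> {}" "subset.chain A C"
    then have CA: "C \<subseteq> A" and tot: "\<And>X Y. X \<in> C \<Longrightarrow> Y \<in> C \<Longrightarrow> X \<subseteq> Y \<or> Y \<subseteq> X"
      by (auto simp: subset_chain_def)
    have sub: "\<And>X. X \<in> C \<Longrightarrow> subspace X" using CA by (auto simp: A_def)
    have "subspace (\<Union>C)"
    proof (rule subspaceI)
      show "0 \<in> \<Union>C" using C(1) sub subspace_0 by blast
      show "x + y \<in> \<Union>C" if xy: "x \<in> \<Union>C" "y \<in> \<Union>C" for x y
      proof -
        from xy obtain X Y where "X \<in> C" "Y \<in> C" "x \<in> X" "y \<in> Y" by blast
        then show ?thesis using tot[of X Y] sub[of X] sub[of Y] by (metis UnionI subset_eq subspace_add)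
      qed
      show "c *\<^sub>R x \<in> \<Union>C" if "x \<in> \<Union>C" for c x
        using that sub subspace_scale by blast
    qed
    with C(1) CA show "\<Union>C \<in> A" by (fastforce simp: A_def)
  qed
  then obtain H where HA: "H \<in> A" and max: "\<And>X. X \<in> A \<Longrightarrow> H \<subseteq> X \<Longrightarrow> X = H" by blast
  from HA have H: "subspace H" and MH: "M \<subseteq> H" and Hle: "\<And>x r. (x, r) \<in> H \<Longrightarrow> r \<le> norm x"
    by (auto simp: A_def)
  have single: "r = s" if "(x, r) \<in> H" "(x, s) \<in> H" for x r s
    using Hle[of 0 "r - s"] Hle[of 0 "s - r"] subspace_diff[OF H that] subspace_diff[OF H that(2,1)]
    by simp
  have total: "\<exists>r. (z, r) \<in> H" for z
  proof -
    \<comment> \<open>The value at \<open>z\<close> has to lie above all left sides and below all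
      right sides. The triangle inequality makes the two families compatible, and the supremum
      \<open>c\<close> of the left sides is one admissible value.\<close>
    have key: "r - norm (x - z) \<le> norm (y + z) - s" if "(x, r) \<in> H" "(y, s) \<in> H" for x r y s
    proof -
      have "r + s \<le> norm (x + y)" using Hle subspace_add[OF H that] by simp
      also have "\<dots> = norm ((x - z) + (y + z))" by simp
      also have "\<dots> \<le> norm (x - z) + norm (y + z)" by (rule norm_triangle_ineq)
      finally show ?thesis by simp
    qed
    define c where "c = (SUP p\<in>H. snd p - norm (fst p - z))"
    have H0: "(0, 0) \<in> H" using subspace_0[OF H] by (simp add: zero_prod_def)
    have lower: "r - norm (x - z) \<le> c" if "(x, r) \<in> H" for x r
    proof -
      have "bdd_above ((\<lambda>p. snd p - norm (fst p - z)) ` H)"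
        using key[OF _ H0] by (auto intro!: bdd_aboveI)
      from cSUP_upper[OF that this] show ?thesis by (simp add: c_def)
    qed
    have upper: "c \<le> norm (y + z) - s" if "(y, s) \<in> H" for y s
      unfolding c_def using H0 key[OF _ that] by (intro cSUP_least) auto
    define H' where "H' = {h + k |h k. h \<in> H \<and> k \<in> span {(z, c)}}"
    have H'I: "h + k \<in> H'" if "h \<in> H" "k \<in> span {(z, c)}" for h k
      unfolding H'_def using that by blast
    \<comment> \<open>Dividing by the absolute value of \<open>t\<close> reduces the claim to
      \<open>t = 1\<close> and \<open>t = -1\<close>, which are \<open>upper\<close> and
      \<open>lower\<close>.\<close>
    have "r + t * c \<le> norm (x + t *\<^sub>R z)" if xr: "(x, r) \<in> H" for x r t
    proof -
      have sc: "(x /\<^sub>R a, r / a) \<in> H" for a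
        using subspace_scale[OF H xr, of "inverse a"] by (simp add: divide_inverse mult.commute)
      consider "t = 0" | "t > 0" | "t < 0" by linarith
      then show ?thesis
      proof cases
        case 1 then show ?thesis using Hle xr by simp
      next
        case 2
        then have "t * c \<le> t * (norm (x /\<^sub>R t + z) - r / t)"
          using upper[OF sc] by (intro mult_left_mono) auto
        also have "\<dots> = norm (t *\<^sub>R (x /\<^sub>R t + z)) - r" using 2 by (simp add: right_diff_distrib)
        also have "t *\<^sub>R (x /\<^sub>R t + z) = x + t *\<^sub>R z" using 2 by (simp add: scaleR_add_right)
        finally show ?thesis by simp
      next
        case 3
        define s where "s = - t"
        have s: "s > 0" using 3 by (simp add: s_def)
        have "r - norm (s *\<^sub>R (x /\<^sub>R s - z)) = s * (r / s - norm (x /\<^sub>R s - z))"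
          using s by (simp add: right_diff_distrib)
        also have "\<dots> \<le> s * c" by (rule mult_left_mono[OF lower[OF sc]]) (use s in simp)
        also have "s *\<^sub>R (x /\<^sub>R s - z) = x - s *\<^sub>R z" using s by (simp add: scaleR_diff_right)
        finally show ?thesis by (simp add: s_def)
      qed
    qed
    note dominated = this
    have "r \<le> norm x" if xr: "(x, r) \<in> H'" for x r
    proof -
      obtain h t where "h \<in> H" "(x, r) = h + t *\<^sub>R (z, c)"
        using xr unfolding H'_def span_singleton by (elim CollectE exE conjE rangeE) blast
      then show ?thesis using dominated[of "fst h" "snd h" t] by (cases h) simp
    qed
    moreover have "H \<subseteq> H'"
    proof
      fix h assume "h \<in> H"
      then have "h + 0 \<in> H'" by (intro H'I span_0)
      then show "h \<in> H'" by simp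
    qed
    moreover have "subspace H'" unfolding H'_def by (intro subspace_sums H subspace_span)
    ultimately have "H' \<in> A"
      using MH unfolding A_def by blast
    from max[OF this \<open>H \<subseteq> H'\<close>] have "H' = H" .
    moreover have "(0, 0) + (z, c) \<in> H'" using H0 by (intro H'I span_base) auto
    ultimately have "(z, c) \<in> H" by simp
    then show ?thesis ..
  qed
  define u where "u x = (SOME r. (x, r) \<in> H)" for x
  have uH: "(x, u x) \<in> H" for x unfolding u_def using total by (rule someI_ex)
  show ?thesis
  proof (intro exI conjI allI impI)
    show "linear u"
    proof (rule linearI)
      show "u (x + y) = u x + u y" for x y
        using single[OF uH, of "x + y" "u x + u y"] subspace_add[OF H uH uH, of x y] by simp
      show "u (c *\<^sub>R x) = c *\<^sub>R u x" for c x
        using single[OF uH, of "c *\<^sub>R x" "c * u x"] subspace_scale[OF H uH, of c x] by simp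
    qed
    show "u x \<le> norm x" for x using Hle uH by blast
    show "u x = r" if "(x, r) \<in> M" for x r using single[OF uH] MH that by blast
  qed
qed

text \<open>Let \<open>d\<close> be a positive lower bound for the distance from \<open>b\<close> to
  \<open>W\<close>. On the span of \<open>W\<close> and \<open>b\<close>, the functional that kills
  \<open>W\<close> and sends \<open>b\<close> to \<open>d\<close> is dominated by the norm; its
  graph \<open>M\<close> is what Hahn-Banach extends.\<close>

lemma separating_functional:
  fixes W :: "'a::real_normed_vector set"
  assumes W: "subspace W" "closed W" and b: "b \<notin> W"
  obtains u :: "'a \<Rightarrow> real" where "bounded_linear u" "\<And>w. w \<in> W \<Longrightarrow> u w = 0" "u b \<noteq> 0"
proof -
  obtain d where d: "d > 0" "ball b d \<subseteq> - W"
    using W(2) b by (metis Compl_iff open_Compl openE)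
  have far: "d \<le> norm (w + b)" if "w \<in> W" for w
  proof (rule ccontr)
    assume "\<not> ?thesis"
    then have "- w \<in> ball b d" by (simp add: dist_norm add.commute)
    then show False using d(2) subspace_neg[OF W(1) that] by blast
  qed
  define M where "M = {h + k |h k. h \<in> W \<times> {0} \<and> k \<in> span {(b, d)}}"
  have "subspace (W \<times> {0::real})" using W(1) by (intro subspace_Times) auto
  then have M: "subspace M" unfolding M_def by (intro subspace_sums subspace_span)
  have "t * d \<le> norm (w + t *\<^sub>R b)" if w: "w \<in> W" for w t
  proof (cases "t \<le> 0")
    case True
    then have "t * d \<le> 0" using d(1) by (simp add: mult_nonpos_nonneg)
    then show ?thesis using norm_ge_zero order_trans by blast
  next
    case False
    then have "t * d \<le> t * norm (w /\<^sub>R t + b)"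
      using far[OF subspace_scale[OF W(1) w]] by simp
    also have "\<dots> = norm (t *\<^sub>R (w /\<^sub>R t + b))" using False by simp
    also have "t *\<^sub>R (w /\<^sub>R t + b) = w + t *\<^sub>R b" using False by (simp add: scaleR_add_right)
    finally show ?thesis .
  qed
  note far_multiple = this
  have dom: "r \<le> norm x" if xr: "(x, r) \<in> M" for x r
  proof -
    obtain w t where "w \<in> W" "(x, r) = (w, 0) + t *\<^sub>R (b, d)"
      using xr by (auto simp: M_def span_singleton)
    then show ?thesis using far_multiple[of w t] by simp
  qed
  from hahn_banach_graph[OF M dom] obtain u
    where "linear u \<and> (\<forall>x. u x \<le> norm x) \<and> (\<forall>x r. (x, r) \<in> M \<longrightarrow> u x = r)" ..
  then have u: "linear u" "\<And>x. u x \<le> norm x" "\<And>x r. (x, r) \<in> M \<Longrightarrow> u x = r" by simp_all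
  show ?thesis
  proof
    show "bounded_linear u"
    proof (rule bounded_linear_intro)
      show "norm (u x) \<le> norm x * 1" for x
        using u(2)[of x] u(2)[of "- x"] linear_neg[OF u(1), of x] by auto
    qed (auto simp: linear_add[OF u(1)] linear_scale[OF u(1)])
    have MI: "h + k \<in> M" if "h \<in> W \<times> {0}" "k \<in> span {(b, d)}" for h k
      unfolding M_def using that by blast
    have "(w, 0) + 0 \<in> M" if "w \<in> W" for w
      using that by (intro MI span_0) simp
    then show "u w = 0" if "w \<in> W" for w using u(3) that by simp
    have "(0, 0) + (b, d) \<in> M"
      using subspace_0[OF W(1)] by (intro MI span_base) auto
    then show "u b \<noteq> 0" using u(3)[of b d] d(1) by simp
  qed
qed

section \<open>Path lifting in covering spaces\<close>

lemma covering_space_evenly_covered: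
  assumes "covering_space UNIV q S" "x \<in> S"
  obtains T v where "x \<in> T" "openin (top_of_set S) T" "\<Union>v = q -` T" "\<And>u. u \<in> v \<Longrightarrow> open u"
    "pairwise disjnt v" "\<And>u. u \<in> v \<Longrightarrow> \<exists>p. homeomorphism u T q p"
proof -
  have "\<forall>x\<in>S. \<exists>T. x \<in> T \<and> openin (top_of_set S) T \<and>
    (\<exists>v. \<Union>v = q -` T \<and> (\<forall>u\<in>v. open u) \<and> pairwise disjnt v \<and> (\<forall>u\<in>v. \<exists>p. homeomorphism u T q p))"
    using assms(1) by (simp add: covering_space_def)
  from bspec[OF this assms(2)] obtain T v where "x \<in> T" "openin (top_of_set S) T"
    "\<Union>v = q -` T" "\<forall>u\<in>v. open u" "pairwise disjnt v" "\<forall>u\<in>v. \<exists>p. homeomorphism u T q p"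
    by (elim exE conjE)
  with that[of T v] show ?thesis by simp
qed

text \<open>The set where the lifts agree is open because \<open>q\<close> is injective on each
  sheet. Its complement is open because points with equal image that differ lie in disjoint sheets;
  this replaces a closed diagonal, as \<open>'g\<close> is an arbitrary topological space.
  Connectedness of the unit interval concludes.\<close>

lemma covering_space_path_lift_unique:
  fixes q :: "'g::topological_space \<Rightarrow> 'b::topological_space"
  assumes cov: "covering_space UNIV q S" and h: "path h1" "path h2"
    and eq: "\<And>t. t \<in> {0..1} \<Longrightarrow> q (h1 t) = q (h2 t)" and start: "h1 0 = h2 0"
    and t: "t \<in> {0..1}"
  shows "h1 t = h2 t"
proof -
  let ?I = "top_of_set {0..1::real}" and ?E = "{t \<in> {0..1}. h1 t = h2 t}"
  have qS: "q y \<in> S" for y using cov by (auto simp: covering_space_def)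
  have inj: "a = b" if "\<exists>p. homeomorphism u T q p" "a \<in> u" "b \<in> u" "q a = q b" for a b u T
    using that by (metis homeomorphism_apply1)
  have pre: "openin ?I {t \<in> {0..1}. h1 t \<in> u \<and> h2 t \<in> u'}" if "open u" "open u'" for u u'
  proof -
    have "openin ?I ({0..1} \<inter> h1 -` u)" "openin ?I ({0..1} \<inter> h2 -` u')"
      using h that unfolding path_def by (auto intro: continuous_openin_preimage_gen)
    then have "openin ?I (({0..1} \<inter> h1 -` u) \<inter> ({0..1} \<inter> h2 -` u'))" by (rule openin_Int)
    then show ?thesis by (rule back_subst[where P="openin ?I"]) auto
  qed
  have "openin ?I ?E"
  proof (subst openin_subopen, intro ballI)
    fix s assume s: "s \<in> ?E"
    obtain T v where T: "q (h1 s) \<in> T" and v: "\<Union>v = q -` T" "\<And>u. u \<in> v \<Longrightarrow> open u"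
      "\<And>u. u \<in> v \<Longrightarrow> \<exists>p. homeomorphism u T q p"
      using covering_space_evenly_covered[OF cov qS[of "h1 s"]] by metis
    from T v(1) have "h1 s \<in> \<Union>v" by simp
    then obtain u where u: "u \<in> v" "h1 s \<in> u" by blast
    have "h1 t = h2 t" if "t \<in> {0..1}" "h1 t \<in> u" "h2 t \<in> u" for t
      using inj[OF v(3)[OF u(1)] that(2,3) eq[OF that(1)]] .
    then have "{t \<in> {0..1}. h1 t \<in> u \<and> h2 t \<in> u} \<subseteq> ?E" by blast
    then show "\<exists>V. openin ?I V \<and> s \<in> V \<and> V \<subseteq> ?E"
      using pre[OF v(2) v(2), OF u(1) u(1)] s u(2)
      by (intro exI[of _ "{t \<in> {0..1}. h1 t \<in> u \<and> h2 t \<in> u}"]) auto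
  qed
  moreover have "closedin ?I ?E"
  proof -
    have "openin ?I ({0..1} - ?E)"
    proof (subst openin_subopen, intro ballI)
      fix s assume s: "s \<in> {0..1} - ?E"
      then have qeq: "q (h1 s) = q (h2 s)" using eq by simp
      obtain T v where T: "q (h1 s) \<in> T" and v: "\<Union>v = q -` T" "\<And>u. u \<in> v \<Longrightarrow> open u"
        "pairwise disjnt v" "\<And>u. u \<in> v \<Longrightarrow> \<exists>p. homeomorphism u T q p"
        using covering_space_evenly_covered[OF cov qS[of "h1 s"]] by metis
      from T v(1) qeq have "h1 s \<in> \<Union>v" "h2 s \<in> \<Union>v" by simp_all
      then obtain u u' where u: "u \<in> v" "h1 s \<in> u" and u': "u' \<in> v" "h2 s \<in> u'" by blast
      have "u' \<noteq> u" using inj[OF v(4)[OF u(1)] u(2) _ qeq] u'(2) s by blast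
      then have "disjnt u u'" using v(3) u(1) u'(1) by (metis pairwiseD)
      then have "{t \<in> {0..1}. h1 t \<in> u \<and> h2 t \<in> u'} \<subseteq> {0..1} - ?E"
        by (auto simp: disjnt_iff)
      then show "\<exists>V. openin ?I V \<and> s \<in> V \<and> V \<subseteq> {0..1} - ?E"
        using pre[OF v(2) v(2), OF u(1) u'(1)] s u(2) u'(2)
        by (intro exI[of _ "{t \<in> {0..1}. h1 t \<in> u \<and> h2 t \<in> u'}"]) auto
    qed
    then show ?thesis by (auto simp: closedin_def)
  qed
  moreover have "0 \<in> ?E" using start by simp
  ultimately have "?E = {0..1}"
    using connected_Icc[of 0 "1::real"] unfolding connected_clopen by blast
  with t show ?thesis by blast
qed

text \<open>Over a short interval, \<open>g\<close> stays in an evenly covered set and the inverse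
  of \<open>q\<close> on a sheet lifts it. Lifts over adjacent intervals glue, so bisection
  (\<open>Bolzano\<close>) reaches the unit interval. As \<open>g\<close> lives on the whole line,
  the short intervals may stick out of it.\<close>

lemma covering_space_path_lift:
  fixes q :: "'g::topological_space \<Rightarrow> 'b::topological_space"
  assumes cov: "covering_space UNIV q S" and g: "continuous_on UNIV g" "\<And>t::real. g t \<in> S"
    and y: "q y = g 0"
  obtains h where "path h" "h 0 = y" "\<And>t. t \<in> {0..1} \<Longrightarrow> q (h t) = g t"
proof -
  \<comment> \<open>All starting points over \<open>g a\<close> are allowed, so that a second lift
    can start where the first one ends.\<close>
  define P where "P a b \<longleftrightarrow> (\<forall>y. q y = g a \<longrightarrow>
    (\<exists>h. continuous_on {a..b} h \<and> h a = y \<and> (\<forall>t\<in>{a..b}. q (h t) = g t)))" for a b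
  have PD: "\<exists>h. continuous_on {a..b} h \<and> h a = y \<and> (\<forall>t\<in>{a..b}. q (h t) = g t)"
    if "P a b" "q y = g a" for a b y using that by (simp add: P_def)
  have "P 0 1"
  proof (rule Bolzano)
    fix a b c :: real assume ab: "P a b" "P b c" "a \<le> b" "b \<le> c"
    show "P a c" unfolding P_def
    proof (intro allI impI)
      fix y assume "q y = g a"
      from PD[OF ab(1) this] obtain h
        where h: "continuous_on {a..b} h" "h a = y" "\<forall>t\<in>{a..b}. q (h t) = g t" by blast
      then have "q (h b) = g b" using ab(3) by simp
      from PD[OF ab(2) this] obtain k
        where k: "continuous_on {b..c} k" "k b = h b" "\<forall>t\<in>{b..c}. q (k t) = g t" by blast
      have "continuous_on ({a..b} \<union> {b..c}) (\<lambda>t. if t \<le> b then h t else k t)"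
        using h(1) k(1,2) by (intro continuous_on_cases) auto
      moreover have "{a..b} \<union> {b..c} = {a..c}" using ab(3,4) by auto
      ultimately show "\<exists>h. continuous_on {a..c} h \<and> h a = y \<and> (\<forall>t\<in>{a..c}. q (h t) = g t)"
        using h k ab(3) by (intro exI[of _ "\<lambda>t. if t \<le> b then h t else k t"]) auto
    qed
  next
    fix x :: real
    obtain T where T: "g x \<in> T" "openin (top_of_set S) T"
      and lift: "\<And>y. q y \<in> T \<Longrightarrow> \<exists>u p. y \<in> u \<and> homeomorphism u T q p"
    proof -
      obtain T v where T: "g x \<in> T" "openin (top_of_set S) T" and v: "\<Union>v = q -` T"
        "\<And>u. u \<in> v \<Longrightarrow> \<exists>p. homeomorphism u T q p"
        using covering_space_evenly_covered[OF cov g(2)[of x]] by metis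
      show ?thesis
      proof (rule that[OF T(1,2)])
        fix y assume "q y \<in> T"
        then have "y \<in> \<Union>v" using v(1) by simp
        then show "\<exists>u p. y \<in> u \<and> homeomorphism u T q p" using v(2) by blast
      qed
    qed
    from T(2) obtain O' where O': "open O'" "T = S \<inter> O'" by (auto simp: openin_open)
    have "open (g -` O')" using g(1) O'(1) by (simp add: open_vimage)
    then obtain d where d: "d > 0" "ball x d \<subseteq> g -` O'"
      using T(1) O'(2) by (auto elim: openE)
    show "\<exists>d>0. \<forall>a b. a \<le> x \<and> x \<le> b \<and> b - a < d \<longrightarrow> P a b"
    proof (intro exI[of _ d] conjI allI impI)
      fix a b assume ab: "a \<le> x \<and> x \<le> b \<and> b - a < d"
      have gT: "g t \<in> T" if "t \<in> {a..b}" for t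
      proof -
        have "t \<in> ball x d" using that ab by (auto simp: dist_real_def)
        then show ?thesis using d(2) O'(2) g(2) by blast
      qed
      show "P a b" unfolding P_def
      proof (intro allI impI)
        fix y assume y: "q y = g a"
        with gT[of a] ab lift[of y] obtain u p where u: "y \<in> u" "homeomorphism u T q p" by auto
        have "continuous_on {a..b} (p \<circ> g)"
        proof (rule continuous_on_compose)
          show "continuous_on {a..b} g" using g(1) continuous_on_subset by blast
          have "continuous_on T p" using u(2) by (simp add: homeomorphism_def)
          then show "continuous_on (g ` {a..b}) p" using gT by (auto intro: continuous_on_subset)
        qed
        then show "\<exists>h. continuous_on {a..b} h \<and> h a = y \<and> (\<forall>t\<in>{a..b}. q (h t) = g t)"
          using u gT y by (intro exI[of _ "p \<circ> g"]) (auto simp: homeomorphism_def)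
      qed
    qed (use d in auto)
  qed simp
  from PD[OF this y] obtain h
    where "continuous_on {0..1} h" "h 0 = y" "\<forall>t\<in>{0..1}. q (h t) = g t" by blast
  with that show ?thesis by (auto simp: path_def)
qed

section \<open>Entire power series in commutative Banach algebras\<close>

definition power_series :: "(nat \<Rightarrow> real) \<Rightarrow> 'a \<Rightarrow> 'a::{banach,real_normed_algebra,comm_ring_1}" where
  "power_series c x = (\<Sum>n. c n *\<^sub>R x ^ n)"

definition entire_coeffs :: "(nat \<Rightarrow> real) \<Rightarrow> bool" where
  "entire_coeffs c \<longleftrightarrow> (\<forall>r. summable (\<lambda>n. c n * r ^ n))"

text \<open>The factor \<open>norm 1\<close> is forced by \<open>n = 0\<close>, since the norm of
  the unit is not normalised.\<close>

lemma norm_power_le: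
  fixes x :: "'a::{real_normed_algebra,comm_ring_1}"
  shows "norm (x ^ n) \<le> norm (1::'a) * norm x ^ n"
proof (induction n)
  case (Suc n)
  have "norm (x ^ Suc n) \<le> norm x * norm (x ^ n)" by (simp add: norm_mult_ineq)
  also have "\<dots> \<le> norm x * (norm (1::'a) * norm x ^ n)" using Suc by (intro mult_left_mono) auto
  finally show ?case by (simp add: mult_ac)
qed simp

text \<open>Convergence at the larger radius \<open>\<bar>r\<bar> + 1\<close> gives absolute
  convergence at \<open>r\<close>.\<close>

lemma entire_coeffs_abs_summable:
  assumes "entire_coeffs c"
  shows "summable (\<lambda>n. \<bar>c n\<bar> * r ^ n)"
proof (rule summable_norm_cancel)
  have "summable (\<lambda>n. norm (c n * r ^ n))"
    using assms by (intro powser_insidea[of _ "\<bar>r\<bar> + 1"]) (auto simp: entire_coeffs_def)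
  then show "summable (\<lambda>n. norm (\<bar>c n\<bar> * r ^ n))" by (simp add: abs_mult)
qed

lemma entire_coeffs_diffs: "entire_coeffs c \<Longrightarrow> entire_coeffs (diffs c)"
  unfolding entire_coeffs_def by (auto intro: termdiff_converges_all)

lemma power_series_sums:
  fixes x :: "'a::{banach,real_normed_algebra,comm_ring_1}"
  assumes "entire_coeffs c"
  shows "(\<lambda>n. c n *\<^sub>R x ^ n) sums power_series c x"
proof -
  have "summable (\<lambda>n. norm (1::'a) * (\<bar>c n\<bar> * norm x ^ n))"
    by (intro summable_mult entire_coeffs_abs_summable assms)
  moreover have "norm (c n *\<^sub>R x ^ n) \<le> norm (1::'a) * (\<bar>c n\<bar> * norm x ^ n)" for n
    using mult_left_mono[OF norm_power_le[of x n], of "\<bar>c n\<bar>"] by (simp add: mult_ac)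
  ultimately have "summable (\<lambda>n. c n *\<^sub>R x ^ n)" by (rule summable_comparison_test'[of _ 0])
  then show ?thesis unfolding power_series_def by (rule summable_sums)
qed


lemma has_derivative_ring_power:
  fixes x :: "'a::{real_normed_algebra,comm_ring_1}"
  shows "((\<lambda>x. x ^ n) has_derivative (\<lambda>h. real n *\<^sub>R (x ^ (n - 1) * h))) (at x within S)"
proof (induction n)
  case (Suc n)
  have "((\<lambda>x. x * x ^ n) has_derivative (\<lambda>h. x * (real n *\<^sub>R (x ^ (n - 1) * h)) + h * x ^ n)) (at x within S)"
    by (rule has_derivative_mult[OF has_derivative_ident Suc])
  moreover have "x * (real n *\<^sub>R (x ^ (n - 1) * h)) + h * x ^ n = real (Suc n) *\<^sub>R (x ^ (Suc n - 1) * h)" for h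
  proof (cases n)
    case (Suc m)
    have "x * (r *\<^sub>R (x ^ m * h)) + h * x ^ Suc m = (r + 1) *\<^sub>R (x ^ Suc m * h)" for r
      by (simp add: scaleR_add_left mult_ac)
    then show ?thesis using Suc by (simp add: add.commute)
  qed simp
  ultimately show ?case by simp
qed simp

text \<open>Termwise differentiation on a ball around 0 that contains \<open>x\<close>: the
  differentiated terms are bounded there by those of an absolutely convergent real series at
  \<open>R\<close>, so the Weierstrass test gives uniform convergence.\<close>

lemma power_series_has_derivative:
  fixes x :: "'a::{banach,real_normed_algebra,comm_ring_1}"
  assumes c: "entire_coeffs c"
  shows "(power_series c has_derivative (\<lambda>h. power_series (diffs c) x * h)) (at x)"
proof -
  define R where "R = norm x + 1"
  define S where "S = ball (0::'a) R"
  have R: "R > 0" and x: "x \<in> S" by (simp_all add: R_def S_def add_nonneg_pos)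
  \<comment> \<open>At \<open>n = 0\<close> the truncated exponent \<open>n - 1\<close> is harmless
    because the coefficient is 0.\<close>
  define d :: "nat \<Rightarrow> 'a \<Rightarrow> 'a" where "d n y = (real n * c n) *\<^sub>R y ^ (n - 1)" for n y
  have d_sums: "(\<lambda>n. d n y) sums power_series (diffs c) y" for y
  proof -
    have "(\<lambda>n. d (Suc n) y) sums power_series (diffs c) y"
      using power_series_sums[OF entire_coeffs_diffs[OF c], of y] by (simp add: d_def diffs_def)
    moreover have "d 0 y = 0" by (simp add: d_def)
    ultimately show ?thesis using sums_Suc[of "\<lambda>n. d n y"] by simp
  qed
  have unif: "uniform_limit S (\<lambda>n y. \<Sum>i<n. d i y) (\<lambda>y. \<Sum>i. d i y) sequentially"
  proof (rule Weierstrass_m_test)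
    define M where "M n = norm (1::'a) * (\<bar>real n * c n\<bar> * R ^ (n - 1))" for n
    have "summable (\<lambda>n. norm (1::'a) * (\<bar>diffs c n\<bar> * R ^ n))"
      by (intro summable_mult entire_coeffs_abs_summable entire_coeffs_diffs c)
    then have "summable (\<lambda>n. M (Suc n))" by (simp add: M_def diffs_def)
    then show "summable M" by (simp only: summable_Suc_iff)
    show "norm (d n y) \<le> M n" if "y \<in> S" for n y
    proof -
      have "norm (y ^ (n - 1)) \<le> norm (1::'a) * norm y ^ (n - 1)" by (rule norm_power_le)
      also have "\<dots> \<le> norm (1::'a) * R ^ (n - 1)"
        using that by (intro mult_left_mono power_mono) (auto simp: S_def)
      finally have "\<bar>real n * c n\<bar> * norm (y ^ (n - 1)) \<le> \<bar>real n * c n\<bar> * (norm (1::'a) * R ^ (n - 1))"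
        by (intro mult_left_mono) auto
      then show ?thesis by (simp add: d_def M_def mult_ac)
    qed
  qed
  have "\<exists>g. \<forall>y\<in>S. (\<lambda>n. c n *\<^sub>R y ^ n) sums g y \<and>
    (g has_derivative (\<lambda>h. power_series (diffs c) y * h)) (at y within S)"
  proof (rule has_derivative_series)
    show "convex S" by (simp add: S_def)
    show "((\<lambda>y. c n *\<^sub>R y ^ n) has_derivative (\<lambda>h. d n y * h)) (at y within S)" for n y
      using has_derivative_scaleR_right[OF has_derivative_ring_power[of n y S], of "c n"]
      by (simp add: d_def mult.commute)
    show "\<forall>\<^sub>F n in sequentially. \<forall>y\<in>S. \<forall>h.
      norm ((\<Sum>i<n. d i y * h) - power_series (diffs c) y * h) \<le> e * norm h" if "e > 0" for e
      using uniform_limitD[OF unif that]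
    proof (eventually_elim, intro ballI allI)
      fix n y h assume *: "\<forall>y\<in>S. dist (\<Sum>i<n. d i y) (\<Sum>i. d i y) < e" and y: "y \<in> S"
      have "norm ((\<Sum>i<n. d i y * h) - power_series (diffs c) y * h) =
          norm (((\<Sum>i<n. d i y) - (\<Sum>i. d i y)) * h)"
        by (simp add: sums_unique[OF d_sums, symmetric] sum_distrib_right left_diff_distrib)
      also have "\<dots> \<le> norm ((\<Sum>i<n. d i y) - (\<Sum>i. d i y)) * norm h" by (rule norm_mult_ineq)
      also have "\<dots> \<le> e * norm h" using * y by (intro mult_right_mono) (auto simp: dist_norm less_imp_le)
      finally show "norm ((\<Sum>i<n. d i y * h) - power_series (diffs c) y * h) \<le> e * norm h" .
    qed
    show "x \<in> S" by fact
    show "(\<lambda>n. c n *\<^sub>R x ^ n) sums power_series c x" by (rule power_series_sums[OF c])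
  qed
  then obtain g where g: "\<And>y. y \<in> S \<Longrightarrow> (\<lambda>n. c n *\<^sub>R y ^ n) sums g y"
    "(g has_derivative (\<lambda>h. power_series (diffs c) x * h)) (at x within S)"
    using x by blast
  have "(g has_derivative (\<lambda>h. power_series (diffs c) x * h)) (at x)"
    using g(2) x at_within_open[of x S] by (simp add: S_def)
  moreover have "g y = power_series c y" if "y \<in> S" for y
    using sums_unique2[OF g(1)[OF that] power_series_sums[OF c]] .
  ultimately show ?thesis
    using has_derivative_transform_within_open[of g _ x UNIV S "power_series c"] x by (simp add: S_def)
qed

lemma power_series_at_0: "power_series c 0 = c 0 *\<^sub>R 1"
proof -
  have "power_series c 0 = (\<Sum>n. c n *\<^sub>R (0::'a) ^ n)" by (simp add: power_series_def)
  also have "\<dots> = (\<Sum>n\<in>{0}. c n *\<^sub>R (0::'a) ^ n)" by (intro suminf_finite) (auto simp: power_0_left)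
  finally show ?thesis by simp
qed

section \<open>Hyperbolic series and their differential relations\<close>

text \<open>For \<open>X \<in> sl2\<close> the Cayley-Hamilton theorem gives \<open>X ** X = \<delta>\<close> with \<open>\<delta> = - det X\<close>, so that
  \<open>exp X = C(\<delta>) + S(\<delta>) X\<close>, where formally \<open>C(\<delta>) = cosh \<surd>\<delta>\<close> and \<open>S(\<delta>) = sinh \<surd>\<delta> / \<surd>\<delta>\<close>. This replaces
  calculus in the noncommutative matrix algebra by power series over the commutative \<open>'a\<close>.\<close>

definition cosh_coeffs :: "nat \<Rightarrow> real" where "cosh_coeffs n = 1 / fact (2 * n)"

definition sinh_coeffs :: "nat \<Rightarrow> real" where "sinh_coeffs n = 1 / fact (2 * n + 1)"

lemma entire_coeffs_bound:
  assumes "\<And>n. \<bar>c n\<bar> \<le> 1 / fact n"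
  shows "entire_coeffs c"
  unfolding entire_coeffs_def
proof
  fix r :: real
  have "norm (c n * r ^ n) \<le> inverse (fact n) * \<bar>r\<bar> ^ n" for n
    using mult_right_mono[OF assms[of n], of "\<bar>r\<bar> ^ n"] by (simp add: abs_mult power_abs divide_inverse)
  then show "summable (\<lambda>n. c n * r ^ n)"
    by (intro summable_comparison_test'[OF summable_exp[of "\<bar>r\<bar>"], of 0]) auto
qed

lemma entire_cosh_coeffs: "entire_coeffs cosh_coeffs"
  by (rule entire_coeffs_bound) (auto simp: cosh_coeffs_def intro!: divide_left_mono fact_mono)

lemma entire_sinh_coeffs: "entire_coeffs sinh_coeffs"
  by (rule entire_coeffs_bound)
    (auto simp: sinh_coeffs_def simp del: fact_Suc intro!: divide_left_mono fact_mono)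

text \<open>The chain rule for \<open>cosh \<surd>\<delta>\<close>, that is \<open>2 C' = S\<close>,
  read off on coefficients.\<close>

lemma diffs_cosh_coeffs: "diffs cosh_coeffs n = sinh_coeffs n / 2"
proof -
  have "fact (2 * Suc n) = 2 * real (Suc n) * fact (2 * n + 1)" by simp
  moreover have "real (Suc n) * (1 / (2 * real (Suc n) * F)) = 1 / F / 2" for F
    by (simp del: of_nat_Suc)
  ultimately show ?thesis by (simp only: diffs_def cosh_coeffs_def sinh_coeffs_def)
qed

lemma power_series_diffs_cosh:
  fixes x :: "'a::{banach,real_normed_algebra,comm_ring_1}"
  shows "power_series (diffs cosh_coeffs) x = (1 / 2) *\<^sub>R power_series sinh_coeffs x"
proof -
  have "(\<lambda>n. diffs cosh_coeffs n *\<^sub>R x ^ n) sums ((1 / 2) *\<^sub>R power_series sinh_coeffs x)"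
    using sums_scaleR_right[OF power_series_sums[OF entire_sinh_coeffs, of x], of "1 / 2"]
    by (simp add: diffs_cosh_coeffs)
  then show ?thesis by (simp add: power_series_def sums_iff)
qed

text \<open>Formally this comes from differentiating
  \<open>\<surd>\<delta> S(\<delta>) = sinh \<surd>\<delta>\<close>. On coefficients it says that
  \<open>2 n + 1\<close> times \<open>1 / fact (2 * n + 1)\<close> is
  \<open>1 / fact (2 * n)\<close>.\<close>

lemma power_series_diffs_sinh:
  fixes x :: "'a::{banach,real_normed_algebra,comm_ring_1}"
  shows "2 *\<^sub>R (x * power_series (diffs sinh_coeffs) x) + power_series sinh_coeffs x =
    power_series cosh_coeffs x"
proof -
  have "(\<lambda>n. x * (diffs sinh_coeffs n *\<^sub>R x ^ n)) sums (x * power_series (diffs sinh_coeffs) x)"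
    by (intro sums_mult power_series_sums entire_coeffs_diffs entire_sinh_coeffs)
  then have "(\<lambda>n. (real (Suc n) * sinh_coeffs (Suc n)) *\<^sub>R x ^ Suc n) sums (x * power_series (diffs sinh_coeffs) x)"
    by (simp add: diffs_def)
  then have "(\<lambda>n. (real n * sinh_coeffs n) *\<^sub>R x ^ n) sums (x * power_series (diffs sinh_coeffs) x)"
    by (subst (asm) sums_Suc_iff) simp
  from sums_add[OF sums_scaleR_right[OF this, of 2] power_series_sums[OF entire_sinh_coeffs]]
  have "(\<lambda>n. (2 * real n * sinh_coeffs n + sinh_coeffs n) *\<^sub>R x ^ n) sums
      (2 *\<^sub>R (x * power_series (diffs sinh_coeffs) x) + power_series sinh_coeffs x)"
    by (simp add: scaleR_add_left mult.assoc)
  moreover have "2 * real n * sinh_coeffs n + sinh_coeffs n = cosh_coeffs n" for n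
  proof -
    have "2 * real n * sinh_coeffs n + sinh_coeffs n = (2 * real n + 1) * sinh_coeffs n"
      by (simp add: algebra_simps)
    also have "fact (2 * n + 1) = (2 * real n + 1) * fact (2 * n)" by simp
    then have "(2 * real n + 1) * sinh_coeffs n = cosh_coeffs n"
      by (simp only: sinh_coeffs_def cosh_coeffs_def) simp
    finally show ?thesis .
  qed
  ultimately show ?thesis by (simp add: power_series_def sums_iff)
qed

text \<open>Formally \<open>cosh^2 - sinh^2 = 1\<close>, which will make
  \<open>det (matrix_exp X) = 1\<close>. The two differential relations show that the left side has
  derivative 0, so it keeps its value at 0.\<close>

lemma cosh_sinh_series_identity:
  fixes x :: "'a::{banach,real_normed_algebra,comm_ring_1}"
  shows "(power_series cosh_coeffs x)\<^sup>2 - x * (power_series sinh_coeffs x)\<^sup>2 = 1"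
proof -
  let ?C = "power_series cosh_coeffs :: 'a \<Rightarrow> 'a" and ?S = "power_series sinh_coeffs :: 'a \<Rightarrow> 'a"
  let ?S' = "power_series (diffs sinh_coeffs) :: 'a \<Rightarrow> 'a"
  let ?f = "\<lambda>x. ?C x * ?C x - x * (?S x * ?S x)"
  have "(?f has_derivative (\<lambda>h. 0)) (at x)" for x
  proof -
    note C = power_series_has_derivative[OF entire_cosh_coeffs, of x]
      and S = power_series_has_derivative[OF entire_sinh_coeffs, of x]
    have "(?f has_derivative (\<lambda>h. (?C x * (power_series (diffs cosh_coeffs) x * h) +
        (power_series (diffs cosh_coeffs) x * h) * ?C x) -
        (x * (?S x * (?S' x * h) + (?S' x * h) * ?S x) + h * (?S x * ?S x)))) (at x)"
      by (intro has_derivative_diff has_derivative_mult C S has_derivative_ident)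
    moreover have "(?C x * (power_series (diffs cosh_coeffs) x * h) +
        (power_series (diffs cosh_coeffs) x * h) * ?C x) -
        (x * (?S x * (?S' x * h) + (?S' x * h) * ?S x) + h * (?S x * ?S x)) = 0" for h
    proof -
      have "?C x * (power_series (diffs cosh_coeffs) x * h) +
          (power_series (diffs cosh_coeffs) x * h) * ?C x = ?C x * (?S x * h)"
        by (simp add: power_series_diffs_cosh mult_ac flip: scaleR_2)
      moreover have "x * (?S x * (?S' x * h) + (?S' x * h) * ?S x) + h * (?S x * ?S x) =
          (2 *\<^sub>R (x * ?S' x) + ?S x) * (?S x * h)"
        by (simp add: scaleR_2 algebra_simps)
      ultimately show ?thesis by (simp add: power_series_diffs_sinh)
    qed
    ultimately show ?thesis by simp
  qed
  then have "\<exists>c. \<forall>x\<in>UNIV. ?f x = c" by (intro has_derivative_zero_constant) auto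
  then obtain c where "?f y = c" for y by blast
  then have "?f x = ?f 0" by metis
  also have "\<dots> = 1" by (simp add: power_series_at_0 cosh_coeffs_def)
  finally show ?thesis by (simp add: power2_eq_square)
qed

section \<open>The exponential map on \<open>sl2\<close>\<close>

lemma sums_matrixI:
  fixes f :: "nat \<Rightarrow> 'a::real_normed_vector^'n^'m"
  assumes "\<And>i j. (\<lambda>n. f n $ i $ j) sums (E $ i $ j)"
  shows "f sums E"
  using assms unfolding sums_def by (intro vec_tendstoI) simp

lemma sums_even_odd:
  fixes f :: "nat \<Rightarrow> 'a::real_normed_vector"
  assumes "(\<lambda>n. f (2 * n)) sums a" "(\<lambda>n. f (2 * n + 1)) sums b"
  shows "f sums (a + b)"
proof -
  have "(\<lambda>n. if even n then f n else 0) sums a"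
  proof (rule iffD1[OF sums_mono_reindex[of "\<lambda>n. 2 * n"]])
    show "strict_mono (\<lambda>n::nat. 2 * n)" by (simp add: strict_mono_def)
    show "(if even n then f n else 0) = 0" if "n \<notin> range (\<lambda>n. 2 * n)" for n
      using that by (auto elim!: evenE)
  qed (use assms(1) in simp)
  moreover have "(\<lambda>n. if odd n then f n else 0) sums b"
  proof (rule iffD1[OF sums_mono_reindex[of "\<lambda>n. 2 * n + 1"]])
    show "strict_mono (\<lambda>n::nat. 2 * n + 1)" by (simp add: strict_mono_def)
    show "(if odd n then f n else 0) = 0" if "n \<notin> range (\<lambda>n. 2 * n + 1)" for n
      using that by (auto elim!: oddE)
  qed (use assms(2) in simp)
  ultimately have "(\<lambda>n. (if even n then f n else 0) + (if odd n then f n else 0)) sums (a + b)"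
    by (rule sums_add)
  moreover have "(\<lambda>n. (if even n then f n else 0) + (if odd n then f n else 0)) = f" by auto
  ultimately show ?thesis by simp
qed

lemma matrix_mult_2: "(A ** B) $ i $ j = A $ i $ 1 * B $ 1 $ j + A $ i $ 2 * B $ 2 $ j"
  for A B :: "'a::semiring_1^2^2"
  by (simp add: matrix_matrix_mult_def sum_2)

lemma sl2_trace: "X \<in> sl2 \<longleftrightarrow> X $ 2 $ 2 = - (X $ 1 $ 1)"
  by (simp add: sl2_def trace_def sum_2 add_eq_0_iff)

lemma matrix_power_sl2:
  assumes "X \<in> sl2"
  shows "(((**) X) ^^ (2 * n)) (mat 1) = mat ((- det X) ^ n)"
    "(((**) X) ^^ (2 * n + 1)) (mat 1) $ i $ j = (- det X) ^ n * X $ i $ j"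
proof -
  \<comment> \<open>Cayley-Hamilton for trace 0, applied to a scalar matrix because the even powers
    of \<open>X\<close> are scalar.\<close>
  have step: "X ** (X ** mat e) = mat (- det X * e)" for e
    using assms
    by (simp add: vec_eq_iff forall_2 matrix_mult_2 mat_def det_2 sl2_trace algebra_simps)
  show even: "(((**) X) ^^ (2 * n)) (mat 1) = mat ((- det X) ^ n)"
    by (induction n) (simp_all add: step del: mult_minus_left)
  show "(((**) X) ^^ (2 * n + 1)) (mat 1) $ i $ j = (- det X) ^ n * X $ i $ j"
    using exhaust_2[of j] by (simp add: even matrix_mult_2) (auto simp: mat_def)
qed

lemma matrix_exp_sl2:
  assumes X: "X \<in> sl2"
  shows "matrix_exp X $ i $ j =
    (if i = j then power_series cosh_coeffs (- det X) else 0) +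
    power_series sinh_coeffs (- det X) * X $ i $ j"
proof -
  define E :: "'a^2^2" where "E = (\<chi> i j. (if i = j then power_series cosh_coeffs (- det X) else 0) +
    power_series sinh_coeffs (- det X) * X $ i $ j)"
  have "(\<lambda>n. (1 / fact n) *\<^sub>R (((**) X) ^^ n) (mat 1)) sums E"
  proof (rule sums_matrixI)
    fix i j :: 2
    have "(\<lambda>n. if i = j then cosh_coeffs n *\<^sub>R (- det X) ^ n else 0) sums
        (if i = j then power_series cosh_coeffs (- det X) else 0)"
      using power_series_sums[OF entire_cosh_coeffs, of "- det X"] by simp
    moreover have "(\<lambda>n. (sinh_coeffs n *\<^sub>R (- det X) ^ n) * X $ i $ j) sums
        (power_series sinh_coeffs (- det X) * X $ i $ j)"
      by (intro sums_mult2 power_series_sums entire_sinh_coeffs)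
    moreover have "((1 / fact (2 * n)) *\<^sub>R (((**) X) ^^ (2 * n)) (mat 1)) $ i $ j =
        (if i = j then cosh_coeffs n *\<^sub>R (- det X) ^ n else 0)" for n
      by (simp only: matrix_power_sl2(1)[OF X] vector_scaleR_component) (simp add: mat_def cosh_coeffs_def)
    moreover have "((1 / fact (2 * n + 1)) *\<^sub>R (((**) X) ^^ (2 * n + 1)) (mat 1)) $ i $ j =
        (sinh_coeffs n *\<^sub>R (- det X) ^ n) * X $ i $ j" for n
      by (simp only: matrix_power_sl2(2)[OF X] vector_scaleR_component)
        (simp only: sinh_coeffs_def mult_scaleR_left)
    ultimately show "(\<lambda>n. ((1 / fact n) *\<^sub>R (((**) X) ^^ n) (mat 1)) $ i $ j) sums (E $ i $ j)"
      unfolding E_def vec_lambda_beta by (intro sums_even_odd) (simp_all only:)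
  qed
  then have "matrix_exp X = E" unfolding matrix_exp_def by (rule sums_unique[symmetric])
  then show ?thesis by (simp add: E_def)
qed

lemma det_matrix_exp_sl2:
  assumes X: "X \<in> sl2"
  shows "det (matrix_exp X) = 1"
proof -
  define c s where "c = power_series cosh_coeffs (- det X)" and "s = power_series sinh_coeffs (- det X)"
  have "matrix_exp X $ i $ j = (if i = j then c else 0) + s * X $ i $ j" for i j
    unfolding c_def s_def by (rule matrix_exp_sl2[OF X])
  then have "det (matrix_exp X) = c\<^sup>2 - (- det X) * s\<^sup>2"
    using X by (simp add: det_2 sl2_trace algebra_simps power2_eq_square)
  also have "\<dots> = 1" unfolding c_def s_def by (rule cosh_sinh_series_identity)
  finally show ?thesis .
qed

lemma matrix_exp_0: "matrix_exp (0 :: 'a::comm_complex_banach_algebra^2^2) = mat 1"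
  by (simp add: vec_eq_iff matrix_exp_sl2 sl2_trace det_2 power_series_at_0 cosh_coeffs_def mat_def)

lemma scaleR_sl2: "X \<in> sl2 \<Longrightarrow> t *\<^sub>R X \<in> sl2"
  by (simp add: sl2_trace)

lemma continuous_matrix_exp_ray:
  assumes X: "X \<in> sl2"
  shows "continuous_on UNIV (\<lambda>t. matrix_exp (t *\<^sub>R X))"
proof -
  have cont: "continuous_on UNIV (\<lambda>t. power_series c (- det (t *\<^sub>R X)))" if "entire_coeffs c" for c
  proof (rule continuous_on_compose2[of UNIV "power_series c"])
    show "continuous_on UNIV (power_series c)"
      using power_series_has_derivative[OF that]
      by (intro has_derivative_continuous_on[of _ _ "\<lambda>x h. power_series (diffs c) x * h"]) auto
    show "continuous_on UNIV (\<lambda>t. - det (t *\<^sub>R X))"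
      by (simp add: det_2) (intro continuous_intros)
  qed simp
  have diag: "continuous_on UNIV (\<lambda>t. if i = j then power_series cosh_coeffs (- det (t *\<^sub>R X)) else 0)"
    for i j :: 2
    using cont[OF entire_cosh_coeffs] by (cases "i = j") auto
  have "continuous_on UNIV (\<lambda>t. \<chi> i j. (if i = j then power_series cosh_coeffs (- det (t *\<^sub>R X)) else 0) +
    power_series sinh_coeffs (- det (t *\<^sub>R X)) * (t *\<^sub>R X) $ i $ j)"
    using diag cont[OF entire_sinh_coeffs]
    by (intro continuous_on_vec_lambda continuous_on_add continuous_on_mult) (auto intro!: continuous_intros)
  moreover have "(\<chi> i j. (if i = j then power_series cosh_coeffs (- det (t *\<^sub>R X)) else 0) +
    power_series sinh_coeffs (- det (t *\<^sub>R X)) * (t *\<^sub>R X) $ i $ j) = matrix_exp (t *\<^sub>R X)" for t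
    using matrix_exp_sl2[OF scaleR_sl2[OF X]] by (simp add: vec_eq_iff)
  ultimately show ?thesis by simp
qed

text \<open>The ray is a connected subset of \<open>SL2\<close> through \<open>mat 1\<close>, so it
  stays in the identity component, the base over which paths are lifted.\<close>

lemma matrix_exp_ray_SL2_0:
  assumes X: "X \<in> sl2"
  shows "matrix_exp (t *\<^sub>R X) \<in> SL2_0"
proof -
  have "connected (range (\<lambda>t::real. matrix_exp (t *\<^sub>R X)))"
    using continuous_matrix_exp_ray[OF X] by (intro connected_continuous_image) auto
  moreover have "mat 1 \<in> range (\<lambda>t::real. matrix_exp (t *\<^sub>R X))"
    by (rule range_eqI[of _ _ 0]) (simp add: matrix_exp_0)
  moreover have "range (\<lambda>t::real. matrix_exp (t *\<^sub>R X)) \<subseteq> SL2"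
    using det_matrix_exp_sl2[OF scaleR_sl2[OF X]] by (auto simp: SL2_def)
  ultimately have "range (\<lambda>t::real. matrix_exp (t *\<^sub>R X)) \<subseteq> SL2_0"
    unfolding SL2_0_def by (intro connected_component_maximal)
  then show ?thesis by blast
qed

section \<open>Point derivations\<close>

lemma scaleC_mult_right: "x * c *\<^sub>C y = c *\<^sub>C (x * y)" for x y :: "'a::comm_complex_banach_algebra"
  by (metis scaleC_mult_left mult.commute)

lemma bounded_linear_scaleC: "bounded_linear (scaleC c :: 'a \<Rightarrow> 'a::comm_complex_banach_algebra)"
proof (rule bounded_linear_intro)
  show "c *\<^sub>C r *\<^sub>R x = r *\<^sub>R c *\<^sub>C x" for r and x :: 'a
    by (simp flip: scaleC_of_real add: scaleC_scaleC mult.commute)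
  show "norm (c *\<^sub>C x) \<le> norm x * cmod c" for x :: 'a by (simp add: norm_scaleC mult.commute)
qed (rule scaleC_add_right)

lemma complex_subspace_closure:
  assumes S: "complex_space.subspace S"
  shows "complex_space.subspace (closure S)"
proof (rule complex_space.subspaceI)
  show "0 \<in> closure S" using complex_space.subspace_0[OF S] closure_subset by blast
  show "x + y \<in> closure S" if xy: "x \<in> closure S" "y \<in> closure S" for x y
  proof -
    obtain f g where "\<And>n. f n \<in> S" "f \<longlonglongrightarrow> x" "\<And>n. g n \<in> S" "g \<longlonglongrightarrow> y"
      using xy unfolding closure_sequential by metis
    then have "\<forall>n. f n + g n \<in> S" "(\<lambda>n. f n + g n) \<longlonglongrightarrow> x + y"
      using complex_space.subspace_add[OF S] by (auto intro: tendsto_add)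
    then show ?thesis unfolding closure_sequential by (intro exI[of _ "\<lambda>n. f n + g n"]) simp
  qed
  show "c *\<^sub>C x \<in> closure S" if x: "x \<in> closure S" for c x
  proof -
    obtain f where "\<And>n. f n \<in> S" "f \<longlonglongrightarrow> x"
      using x unfolding closure_sequential by metis
    then have "\<forall>n. c *\<^sub>C f n \<in> S" "(\<lambda>n. c *\<^sub>C f n) \<longlonglongrightarrow> c *\<^sub>C x"
      using complex_space.subspace_scale[OF S]
      by (auto intro: bounded_linear.tendsto[OF bounded_linear_scaleC])
    then show ?thesis unfolding closure_sequential by (intro exI[of _ "\<lambda>n. c *\<^sub>C f n"]) simp
  qed
qed

lemma complex_subspace_imp_subspace: "complex_space.subspace S \<Longrightarrow> subspace S"
  by (auto simp: complex_space.subspace_def subspace_def simp flip: scaleC_of_real)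

lemma complex_separating_functional:
  fixes W :: "'a::comm_complex_banach_algebra set"
  assumes W: "complex_space.subspace W" "closed W" and b: "b \<notin> W"
  obtains D :: "'a \<Rightarrow> complex" where "bounded_linear D" "\<And>c x. D (c *\<^sub>C x) = c * D x"
    "\<And>w. w \<in> W \<Longrightarrow> D w = 0" "D b \<noteq> 0"
proof -
  obtain u :: "'a \<Rightarrow> real" where u: "bounded_linear u" "\<And>w. w \<in> W \<Longrightarrow> u w = 0" "u b \<noteq> 0"
    using separating_functional[OF complex_subspace_imp_subspace[OF W(1)] W(2) b] by metis
  interpret u: bounded_linear u by fact
  have u_scaleC: "u (c *\<^sub>C x) = Re c * u x + Im c * u (\<i> *\<^sub>C x)" for c x
  proof -
    have "c *\<^sub>C x = (of_real (Re c) + of_real (Im c) * \<i>) *\<^sub>C x"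
      using complex_eq[of c] by (simp add: mult.commute)
    also have "\<dots> = of_real (Re c) *\<^sub>C x + of_real (Im c) *\<^sub>C \<i> *\<^sub>C x"
      by (simp only: scaleC_add_left scaleC_scaleC)
    also have "\<dots> = Re c *\<^sub>R x + Im c *\<^sub>R \<i> *\<^sub>C x" by (simp only: scaleC_of_real)
    finally show ?thesis by (simp add: u.add u.scaleR)
  qed
  \<comment> \<open>The complex-linear functional with real part \<open>u\<close>. It vanishes on
    \<open>W\<close> because \<open>W\<close> is stable under \<open>\<i>\<close>, and not at
    \<open>b\<close> because its real part does not.\<close>
  define D where "D x = Complex (u x) (- u (\<i> *\<^sub>C x))" for x
  show ?thesis
  proof
    have "D = (\<lambda>x. of_real (u x) - \<i> * of_real (u (\<i> *\<^sub>C x)))"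
      by (simp add: D_def fun_eq_iff complex_eq_iff)
    moreover have "bounded_linear (\<lambda>x. complex_of_real (u x))"
      by (intro bounded_linear_compose[OF bounded_linear_of_real] u)
    moreover have "bounded_linear (\<lambda>x. \<i> * complex_of_real (u (\<i> *\<^sub>C x)))"
      by (intro bounded_linear_compose[OF bounded_linear_mult_right]
          bounded_linear_compose[OF bounded_linear_of_real]
          bounded_linear_compose[OF u(1)] bounded_linear_scaleC)
    ultimately show "bounded_linear D" by (simp add: bounded_linear_sub)
    show "D (c *\<^sub>C x) = c * D x" for c x
      using u_scaleC[of c x] u_scaleC[of "\<i> * c" x]
      by (simp add: D_def complex_eq_iff scaleC_scaleC algebra_simps)
    show "D w = 0" if "w \<in> W" for w
      using u(2) complex_space.subspace_scale[OF W(1) that] that by (simp add: D_def complex_eq_iff)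
    show "D b \<noteq> 0" using u(3) by (simp add: D_def complex_eq_iff)
  qed
qed

text \<open>Turns the assumed continuity of a character into the norm bound used when
  differentiating through it.\<close>

lemma continuous_linear_imp_bounded_linear:
  fixes f :: "'a::real_normed_vector \<Rightarrow> 'b::real_normed_vector"
  assumes f: "linear f" and cont: "continuous (at 0) f"
  shows "bounded_linear f"
proof -
  obtain d where d: "d > 0" "\<And>x. norm x < d \<Longrightarrow> norm (f x) < 1"
    using cont linear_0[OF f] unfolding continuous_at_eps_delta by (auto simp: dist_norm) (metis zero_less_one)
  show ?thesis
  proof (rule bounded_linear_intro)
    show "norm (f x) \<le> norm x * (2 / d)" for x
    proof (cases "x = 0")
      case False
      let ?r = "d / (2 * norm x)"
      have r: "?r > 0" using False d(1) by simp
      have "norm (?r *\<^sub>R x) < d" using False d(1) by simp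
      from d(2)[OF this] have "?r * norm (f x) < 1" using r d(1) by (simp add: linear_scale[OF f])
      then show ?thesis using False d(1) by (simp add: field_simps)
    qed (simp add: linear_0[OF f])
  qed (simp_all add: linear_add[OF f] linear_scale[OF f])
qed

section \<open>Characters and their point derivations\<close>

lemma banach_character_scaleR: "banach_character \<eta> \<Longrightarrow> \<eta> (r *\<^sub>R x) = r *\<^sub>R \<eta> x"
  unfolding banach_character_def by (metis scaleC_of_real scaleR_conv_of_real)

lemma banach_character_bounded_linear:
  assumes \<eta>: "banach_character \<eta>"
  shows "bounded_linear \<eta>"
proof (rule continuous_linear_imp_bounded_linear)
  show "linear \<eta>"
    using \<eta> banach_character_scaleR[OF \<eta>] by (intro linearI) (auto simp: banach_character_def)
  show "continuous (at 0) \<eta>"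
    using \<eta> by (simp add: banach_character_def continuous_on_eq_continuous_at)
qed

definition point_derivation :: "('a::comm_complex_banach_algebra \<Rightarrow> complex) \<Rightarrow> ('a \<Rightarrow> complex) \<Rightarrow> bool" where
  "point_derivation \<eta> D \<longleftrightarrow> bounded_linear D \<and> (\<forall>c x. D (c *\<^sub>C x) = c * D x) \<and>
     (\<forall>x y. D (x * y) = \<eta> x * D y + \<eta> y * D x)"

lemma complex_subspace_character_kernel:
  "banach_character \<eta> \<Longrightarrow> complex_space.subspace (character_kernel \<eta>)"
  using linear_0[OF bounded_linear.linear[OF banach_character_bounded_linear]]
  by (auto simp: complex_space.subspace_def character_kernel_def banach_character_def)

lemma complex_subspace_closed_square: "complex_space.subspace (closed_square I)"
  unfolding closed_square_def by (intro complex_subspace_closure complex_space.subspace_span)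

text \<open>Hahn-Banach gives a functional that kills all products of two elements of the kernel but
  not \<open>b\<close>. Up to normalisation at 1, killing these products is the Leibniz
  rule.\<close>

lemma point_derivation_separates:
  assumes \<eta>: "banach_character \<eta>" and b: "\<eta> b = 0" "b \<notin> closed_square (character_kernel \<eta>)"
  obtains D where "point_derivation \<eta> D" "D b \<noteq> 0"
proof -
  let ?I = "character_kernel \<eta>"
  obtain D where D: "bounded_linear D" "\<And>c x. D (c *\<^sub>C x) = c * D x"
    "\<And>w. w \<in> closed_square ?I \<Longrightarrow> D w = 0" "D b \<noteq> 0"
  proof (rule complex_separating_functional[OF complex_subspace_closed_square _ b(2)])
    show "closed (closed_square ?I)" by (simp add: closed_square_def)
  qed blast
  interpret D: bounded_linear D by fact
  interpret \<eta>: bounded_linear \<eta> by (rule banach_character_bounded_linear[OF \<eta>])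
  have \<eta>s: "\<eta> (c *\<^sub>C x) = c * \<eta> x" and \<eta>m: "\<eta> (x * y) = \<eta> x * \<eta> y" and \<eta>1: "\<eta> 1 = 1" for c x y
    using \<eta> by (auto simp: banach_character_def)
  \<comment> \<open>\<open>D\<close> need not vanish at \<open>1\<close>; its composition with the projection \<open>N\<close> onto the kernel of \<open>\<eta>\<close> does,
    and that composition is the derivation.\<close>
  define N where "N x = x - \<eta> x *\<^sub>C 1" for x
  have N: "\<eta> (N x) = 0" for x by (simp add: N_def \<eta>.diff \<eta>s \<eta>1)
  have prod: "D (x * y) = 0" if "\<eta> x = 0" "\<eta> y = 0" for x y
  proof (rule D(3))
    have "x * y \<in> {x * y |x y. x \<in> ?I \<and> y \<in> ?I}" using that by (auto simp: character_kernel_def)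
    then show "x * y \<in> closed_square ?I"
      unfolding closed_square_def by (intro subsetD[OF closure_subset] complex_space.span_base)
  qed
  have DN: "D (N x) = D x - \<eta> x * D 1" for x by (simp add: N_def D.diff D(2))
  show ?thesis
  proof
    have "bounded_linear (\<lambda>x. D x - \<eta> x * D 1)"
      by (intro bounded_linear_sub D(1) bounded_linear_compose[OF bounded_linear_mult_left] \<eta>.bounded_linear_axioms)
    moreover have "D (N (c *\<^sub>C x)) = c * D (N x)" for c x
      by (simp add: DN D(2) \<eta>s algebra_simps)
    moreover have "D (N (x * y)) = \<eta> x * D (N y) + \<eta> y * D (N x)" for x y
    proof -
      \<comment> \<open>Both factors lie in the kernel of \<eta>, so \<open>D\<close> kills the
        product; expanding it yields the Leibniz rule.\<close>
      have "N x * N y = x * y - \<eta> x *\<^sub>C y - \<eta> y *\<^sub>C x + (\<eta> x * \<eta> y) *\<^sub>C 1"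
        by (simp add: N_def left_diff_distrib right_diff_distrib scaleC_mult_left scaleC_mult_right scaleC_scaleC
            complex_space.scale_right_diff_distrib)
      then have "D (x * y) - \<eta> x * D y - \<eta> y * D x + \<eta> x * \<eta> y * D 1 = 0"
        using prod[OF N N, of x y] by (simp add: D.add D.diff D(2))
      then show ?thesis by (simp add: DN \<eta>m algebra_simps)
    qed
    ultimately show "point_derivation \<eta> (\<lambda>x. D (N x))"
      by (simp add: point_derivation_def DN)
    show "D (N b) \<noteq> 0" using D(4) b(1) by (simp add: DN)
  qed
qed

section \<open>Finite families of functionals and finite codimension\<close>

text \<open>Induction on \<open>F\<close>: each further functional costs at most one further vector
  in \<open>B\<close>, and none if it already vanishes on the common kernel of the others in
  \<open>I\<close>.\<close>

lemma finite_codim_common_kernel: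
  fixes I :: "'a::comm_complex_banach_algebra set"
  assumes I: "complex_space.subspace I" and "finite F"
    and "\<And>D. D \<in> F \<Longrightarrow> (\<forall>x y. D (x - y) = D x - D y) \<and> (\<forall>c x. D (c *\<^sub>C x) = c * (D x :: complex))"
  shows "\<exists>B. finite B \<and> B \<subseteq> I \<and> (\<forall>v\<in>I. \<exists>w\<in>cspan B. \<forall>D\<in>F. D (v - w) = 0)"
  using assms(2,3)
proof (induction F rule: finite_induct)
  case empty
  show ?case by (rule exI[of _ "{}"]) (auto intro: complex_space.span_zero)
next
  case (insert D F)
  then obtain B where B: "finite B" "B \<subseteq> I" "\<And>v. v \<in> I \<Longrightarrow> \<exists>w\<in>cspan B. \<forall>D\<in>F. D (v - w) = 0"
    by (metis insertI2)
  have lin: "E (x - y) = E x - E y" "E (c *\<^sub>C x) = c * E x" if "E \<in> insert D F" for E x y c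
    using insert.prems[OF that] by auto
  have span_I: "w \<in> I" if "w \<in> cspan B" for w
    using that complex_space.span_minimal[OF B(2) I] by blast
  show ?case
  proof (cases "\<exists>k\<in>I. (\<forall>E\<in>F. E k = 0) \<and> D k \<noteq> 0")
    case False
    have "D (v - w) = 0" if "v \<in> I" "w \<in> cspan B" "\<forall>E\<in>F. E (v - w) = 0" for v w
      using False complex_space.subspace_diff[OF I that(1) span_I[OF that(2)]] that(3) by blast
    then show ?thesis using B by (intro exI[of _ B]) (metis insertE)
  next
    case True
    then obtain k where k: "k \<in> I" "\<And>E. E \<in> F \<Longrightarrow> E k = 0" "D k \<noteq> 0" by blast
    show ?thesis
    proof (intro exI[of _ "insert k B"] conjI ballI)
      fix v assume "v \<in> I"
      from B(3)[OF this] obtain w where w: "w \<in> cspan B" "\<And>E. E \<in> F \<Longrightarrow> E (v - w) = 0" by blast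
      \<comment> \<open>Chosen so that \<open>D\<close> kills \<open>v - w - c *\<^sub>C k\<close>;
        the functionals in \<open>F\<close> are unaffected because they vanish at
        \<open>k\<close>.\<close>
      define c where "c = D (v - w) / D k"
      have "E (v - (w + c *\<^sub>C k)) = E (v - w) - c * E k" if "E \<in> insert D F" for E
        using lin[OF that] by (simp flip: diff_diff_eq)
      moreover have "E (v - w) - c * E k = 0" if "E \<in> insert D F" for E
        using that w(2)[of E] k(2)[of E] k(3) by (cases "E = D") (auto simp: c_def)
      ultimately have "\<forall>E\<in>insert D F. E (v - (w + c *\<^sub>C k)) = 0" by simp
      moreover have "w + c *\<^sub>C k \<in> cspan (insert k B)"
      proof (intro complex_space.span_add complex_space.span_scale)
        show "w \<in> cspan (insert k B)" using w(1) complex_space.span_mono[of B "insert k B"] by blast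
        show "k \<in> cspan (insert k B)" by (rule complex_space.span_base) simp
      qed
      ultimately show "\<exists>w\<in>cspan (insert k B). \<forall>D\<in>insert D F. D (v - w) = 0" by blast
    qed (use B k in auto)
  qed
qed

text \<open>Each \<open>v\<close> differs from some \<open>w\<close> in the span of \<open>B\<close>
  by a common zero of \<open>F\<close>; by \<open>sep\<close> the difference lies in
  \<open>W\<close>, so the two cosets coincide.\<close>

lemma finite_dim_quotient_if_finite_separating:
  fixes I W :: "'a::comm_complex_banach_algebra set"
  assumes I: "complex_space.subspace I" and W: "complex_space.subspace W" and "finite F"
    and lin: "\<And>D. D \<in> F \<Longrightarrow> (\<forall>x y. D (x - y) = D x - D y) \<and> (\<forall>c x. D (c *\<^sub>C x) = c * (D x :: complex))"
    and sep: "\<And>v. v \<in> I \<Longrightarrow> (\<And>D. D \<in> F \<Longrightarrow> D v = 0) \<Longrightarrow> v \<in> W"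
  shows "finite_dim_quotient I W"
proof -
  obtain B where B: "finite B" "B \<subseteq> I" "\<forall>v\<in>I. \<exists>w\<in>cspan B. \<forall>D\<in>F. D (v - w) = 0"
    using finite_codim_common_kernel[OF I \<open>finite F\<close> lin] by blast
  have "additive_coset W v \<in> additive_coset W ` cspan B" if v: "v \<in> I" for v
  proof -
    obtain w where w: "w \<in> cspan B" "\<forall>D\<in>F. D (v - w) = 0" using B(3) v by blast
    have "w \<in> I" using w(1) complex_space.span_minimal[OF B(2) I] by blast
    then have vw: "v - w \<in> W" using w(2) v by (intro sep complex_space.subspace_diff[OF I]) auto
    have "additive_coset W v = additive_coset W w"
    proof (intro subset_antisym subsetI)
      fix x assume "x \<in> additive_coset W v"
      then obtain y where "y \<in> W" "x = v + y" by (auto simp: additive_coset_def)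
      then have "x = w + ((v - w) + y)" "(v - w) + y \<in> W"
        using complex_space.subspace_add[OF W vw] by auto
      then show "x \<in> additive_coset W w" unfolding additive_coset_def by blast
    next
      fix x assume "x \<in> additive_coset W w"
      then obtain y where "y \<in> W" "x = w + y" by (auto simp: additive_coset_def)
      then have "x = v + (y - (v - w))" "y - (v - w) \<in> W"
        using complex_space.subspace_diff[OF W _ vw] by auto
      then show "x \<in> additive_coset W v" unfolding additive_coset_def by blast
    qed
    then show ?thesis using w(1) by blast
  qed
  then show ?thesis unfolding finite_dim_quotient_def quotient_space_def using B(1,2) by blast
qed

section \<open>Sections defined by point derivations\<close>

text \<open>Multiplicativity of \<open>q\<close> only makes the image of the neutral element
  idempotent; this identifies that image.\<close>

lemma SL2_idempotent:
  fixes M :: "'a::comm_ring_1^2^2"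
  assumes "M ** M = M" "det M = 1"
  shows "M = mat 1"
proof -
  \<comment> \<open>the adjugate\<close>
  define N :: "'a^2^2" where
    "N = (\<chi> i j. if i = j then (if i = 1 then M $ 2 $ 2 else M $ 1 $ 1) else - M $ i $ j)"
  have NM: "N ** M = mat 1"
    using assms(2) by (simp add: vec_eq_iff forall_2 matrix_mult_2 N_def mat_def det_2 algebra_simps)
  have "M = (N ** M) ** M" by (simp add: NM)
  also have "\<dots> = N ** M" by (simp add: assms(1) flip: matrix_mul_assoc)
  finally show ?thesis by (simp add: NM)
qed

lemma SL2_0_det: "M \<in> SL2_0 \<Longrightarrow> det M = 1"
  using connected_component_subset[of SL2 "mat 1"] by (auto simp: SL2_0_def SL2_def)

context
  fixes G :: "'g::topological_space monoid" and q :: "'g \<Rightarrow> 'a::comm_complex_banach_algebra^2^2"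
  assumes cover: "simply_connected_covering_group G q SL2_0"
begin

lemma cover_group: "group G" and cover_carrier: "x \<in> carrier G"
  and cover_mult: "q (x \<otimes>\<^bsub>G\<^esub> y) = q x ** q y" and cover_covering: "covering_space UNIV q SL2_0"
  using cover by (simp_all add: simply_connected_covering_group_def)

lemma cover_det: "det (q x) = 1"
  using cover_covering by (intro SL2_0_det) (auto simp: covering_space_def)

lemma cover_one: "q \<one>\<^bsub>G\<^esub> = mat 1"
proof (rule SL2_idempotent)
  interpret group G by (rule cover_group)
  show "q \<one>\<^bsub>G\<^esub> ** q \<one>\<^bsub>G\<^esub> = q \<one>\<^bsub>G\<^esub>" by (simp flip: cover_mult)
qed (rule cover_det)

text \<open>\<open>cover_exp\<close> is a definite description, so its value is known only once the
  ray has a lift (path lifting) and all lifts end at the same point (uniqueness).\<close>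

lemma cover_cover_exp:
  assumes X: "X \<in> sl2"
  shows "q (cover_exp G q X) = matrix_exp X"
proof -
  define lifts where "lifts \<gamma> g \<longleftrightarrow> path \<gamma> \<and> pathstart \<gamma> = \<one>\<^bsub>G\<^esub> \<and> pathfinish \<gamma> = g \<and>
     (\<forall>t\<in>{0..1}. q (\<gamma> t) = matrix_exp (t *\<^sub>R X))" for \<gamma> g
  have "q \<one>\<^bsub>G\<^esub> = matrix_exp (0 *\<^sub>R X)" by (simp add: cover_one matrix_exp_0)
  then obtain h where h: "path h" "h 0 = \<one>\<^bsub>G\<^esub>" "\<And>t. t \<in> {0..1} \<Longrightarrow> q (h t) = matrix_exp (t *\<^sub>R X)"
    using covering_space_path_lift[OF cover_covering continuous_matrix_exp_ray[OF X] matrix_exp_ray_SL2_0[OF X]]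
    by metis
  have "lifts h (h 1)" using h by (simp add: lifts_def pathstart_def pathfinish_def)
  moreover have "g = h 1" if "lifts \<gamma> g" for \<gamma> g
  proof -
    have \<gamma>: "path \<gamma>" "\<gamma> 0 = \<one>\<^bsub>G\<^esub>" "\<gamma> 1 = g" "\<And>t. t \<in> {0..1} \<Longrightarrow> q (\<gamma> t) = matrix_exp (t *\<^sub>R X)"
      using that by (auto simp: lifts_def pathstart_def pathfinish_def)
    have "\<gamma> 1 = h 1"
    proof (rule covering_space_path_lift_unique[OF cover_covering \<gamma>(1) h(1)])
      show "q (\<gamma> t) = q (h t)" if "t \<in> {0..1}" for t using \<gamma>(4)[OF that] h(3)[OF that] by simp
    qed (simp_all add: \<gamma>(2) h(2))
    then show ?thesis using \<gamma>(3) by simp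
  qed
  ultimately have "(THE g. \<exists>\<gamma>. lifts \<gamma> g) = h 1"
    by (intro the_equality exI[of _ h]) (assumption, erule exE)
  then have "cover_exp G q X = h 1" by (simp only: cover_exp_def lifts_def)
  then show ?thesis using h(3)[of 1] by simp
qed

lemma parabolic_upper_triangular:
  assumes "p \<in> parabolic G q"
  shows "q p $ 2 $ 1 = 0"
  using assms unfolding parabolic_def
proof (induction rule: generate.induct)
  interpret group G by (rule cover_group)
  have exp: "q h $ 2 $ 1 = 0" if "h \<in> cover_exp G q ` upper_sl2" for h
    using that by (auto simp: upper_sl2_def cover_cover_exp matrix_exp_sl2)
  {
    case one
    then show ?case by (simp add: cover_one mat_def)
  next
    case (incl h)
    then show ?case by (rule exp)
  next
    case (inv h)
    have "inv\<^bsub>G\<^esub> h \<otimes>\<^bsub>G\<^esub> h = \<one>\<^bsub>G\<^esub>" using cover_carrier by (rule l_inv)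
    then have "q (inv\<^bsub>G\<^esub> h) ** q h = mat 1" by (simp add: cover_one flip: cover_mult)
    then have "(q (inv\<^bsub>G\<^esub> h) ** q h) $ 2 $ 1 = (mat 1 :: 'a^2^2) $ 2 $ 1" by simp
    then have "q (inv\<^bsub>G\<^esub> h) $ 2 $ 1 * q h $ 1 $ 1 = 0"
      using exp[OF inv] by (simp add: matrix_mult_2 mat_def)
    \<comment> \<open>Since \<open>q h\<close> is upper triangular with determinant 1, its diagonal
      entries are inverse to each other, and multiplying by the second cancels the first.\<close>
    then have "q (inv\<^bsub>G\<^esub> h) $ 2 $ 1 * (q h $ 1 $ 1 * q h $ 2 $ 2) = 0" by (simp flip: mult.assoc)
    then show ?case using cover_det[of h] exp[OF inv] by (simp add: det_2)
  next
    case (eng h1 h2)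
    then show ?case by (simp add: cover_mult matrix_mult_2)
  }
qed

end

section \<open>Complex differentiability on \<open>sl2\<close>\<close>

text \<open>The multiplication \<open>s\<close> by complex scalars is a parameter because values in \<open>'a\<close> and in
  \<open>complex\<close> are both needed.\<close>

definition sl2_differentiable ::
  "(complex \<Rightarrow> 'b \<Rightarrow> 'b) \<Rightarrow> ('a::comm_complex_banach_algebra^2^2 \<Rightarrow> 'b::real_normed_vector) \<Rightarrow> 'a^2^2 \<Rightarrow> bool" where
  "sl2_differentiable s F X \<longleftrightarrow>
     (\<exists>D. (F has_derivative D) (at X within sl2) \<and> (\<forall>c. \<forall>Y\<in>sl2. D (matrix_scaleC c Y) = s c (D Y)))"

lemma complex_differentiable_sl2_iff: "complex_differentiable_sl2 = sl2_differentiable (*)"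
  by (simp add: fun_eq_iff complex_differentiable_sl2_def sl2_differentiable_def)

lemma sl2_differentiable_const: "sl2_differentiable scaleC (\<lambda>X. a) X"
  unfolding sl2_differentiable_def by (intro exI[of _ "\<lambda>Y. 0"]) auto

lemma sl2_differentiable_entry: "sl2_differentiable scaleC (\<lambda>X. X $ i $ j) X"
  unfolding sl2_differentiable_def
  by (intro exI[of _ "\<lambda>Y. Y $ i $ j"])
    (auto simp: matrix_scaleC_def intro!: bounded_linear_imp_has_derivative
      bounded_linear_compose[OF bounded_linear_vec_nth bounded_linear_vec_nth])

lemma sl2_differentiable_add:
  assumes "sl2_differentiable scaleC F X" "sl2_differentiable scaleC H X"
  shows "sl2_differentiable scaleC (\<lambda>X. F X + H X) X"
proof -
  from assms obtain D E where "(F has_derivative D) (at X within sl2)" "(H has_derivative E) (at X within sl2)"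
    "\<forall>c. \<forall>Y\<in>sl2. D (matrix_scaleC c Y) = c *\<^sub>C D Y" "\<forall>c. \<forall>Y\<in>sl2. E (matrix_scaleC c Y) = c *\<^sub>C E Y"
    unfolding sl2_differentiable_def by blast
  then show ?thesis unfolding sl2_differentiable_def
    by (intro exI[of _ "\<lambda>Y. D Y + E Y"]) (auto simp: scaleC_add_right intro: has_derivative_add)
qed

lemma sl2_differentiable_mult:
  assumes "sl2_differentiable scaleC F X" "sl2_differentiable scaleC H X"
  shows "sl2_differentiable scaleC (\<lambda>X. F X * H X) X"
proof -
  from assms obtain D E where "(F has_derivative D) (at X within sl2)" "(H has_derivative E) (at X within sl2)"
    "\<forall>c. \<forall>Y\<in>sl2. D (matrix_scaleC c Y) = c *\<^sub>C D Y" "\<forall>c. \<forall>Y\<in>sl2. E (matrix_scaleC c Y) = c *\<^sub>C E Y"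
    unfolding sl2_differentiable_def by blast
  then show ?thesis unfolding sl2_differentiable_def
    by (intro exI[of _ "\<lambda>Y. F X * E Y + D Y * H X"])
      (auto simp: scaleC_add_right scaleC_mult_left scaleC_mult_right intro: has_derivative_mult)
qed

lemma sl2_differentiable_power_series:
  assumes "entire_coeffs c" "sl2_differentiable scaleC F X"
  shows "sl2_differentiable scaleC (\<lambda>X. power_series c (F X)) X"
proof -
  from assms obtain D where "(F has_derivative D) (at X within sl2)"
    "\<forall>c. \<forall>Y\<in>sl2. D (matrix_scaleC c Y) = c *\<^sub>C D Y"
    unfolding sl2_differentiable_def by blast
  then show ?thesis unfolding sl2_differentiable_def
    by (intro exI[of _ "\<lambda>Y. power_series (diffs c) (F X) * D Y"])
      (auto simp: scaleC_mult_right intro!: has_derivative_compose[OF _ power_series_has_derivative[OF assms(1)]])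
qed

lemma sl2_differentiable_functional:
  assumes "bounded_linear f" "\<And>c x. f (c *\<^sub>C x) = c * f x" "sl2_differentiable scaleC F X"
  shows "sl2_differentiable (*) (\<lambda>X. f (F X)) X"
proof -
  from assms obtain D where "(F has_derivative D) (at X within sl2)"
    "\<forall>c. \<forall>Y\<in>sl2. D (matrix_scaleC c Y) = c *\<^sub>C D Y"
    unfolding sl2_differentiable_def by blast
  then show ?thesis unfolding sl2_differentiable_def
    by (intro exI[of _ "\<lambda>Y. f (D Y)"]) (auto simp: assms(2) intro: bounded_linear.has_derivative[OF assms(1)])
qed

lemma sl2_differentiable_complex_mult:
  assumes "sl2_differentiable (*) F X" "sl2_differentiable (*) H X"
  shows "sl2_differentiable (*) (\<lambda>X. F X * H X :: complex) X"
proof -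
  from assms obtain D E where "(F has_derivative D) (at X within sl2)" "(H has_derivative E) (at X within sl2)"
    "\<forall>c. \<forall>Y\<in>sl2. D (matrix_scaleC c Y) = c * D Y" "\<forall>c. \<forall>Y\<in>sl2. E (matrix_scaleC c Y) = c * E Y"
    unfolding sl2_differentiable_def by blast
  then show ?thesis unfolding sl2_differentiable_def
    by (intro exI[of _ "\<lambda>Y. F X * E Y + D Y * H X"]) (auto simp: distrib_left mult_ac(1,3) mult.left_commute intro: has_derivative_mult)
qed

lemma sl2_differentiable_complex_diff:
  assumes "sl2_differentiable (*) F X" "sl2_differentiable (*) H X"
  shows "sl2_differentiable (*) (\<lambda>X. F X - H X :: complex) X"
proof -
  from assms obtain D E where "(F has_derivative D) (at X within sl2)" "(H has_derivative E) (at X within sl2)"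
    "\<forall>c. \<forall>Y\<in>sl2. D (matrix_scaleC c Y) = c * D Y" "\<forall>c. \<forall>Y\<in>sl2. E (matrix_scaleC c Y) = c * E Y"
    unfolding sl2_differentiable_def by blast
  then show ?thesis unfolding sl2_differentiable_def
    by (intro exI[of _ "\<lambda>Y. D Y - E Y"]) (auto simp: algebra_simps intro: has_derivative_diff)
qed

text \<open>The derivative is taken within \<open>sl2\<close>, so a formula valid only for trace 0,
  such as the one for \<open>matrix_exp\<close>, may be substituted.\<close>

lemma sl2_differentiable_cong:
  assumes "\<And>X. X \<in> sl2 \<Longrightarrow> F X = H X" "X \<in> sl2" "sl2_differentiable s H X"
  shows "sl2_differentiable s F X"
proof -
  from assms(3) obtain D where "(H has_derivative D) (at X within sl2)"
    "\<forall>c. \<forall>Y\<in>sl2. D (matrix_scaleC c Y) = s c (D Y)"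
    unfolding sl2_differentiable_def by blast
  moreover from this(1) have "(F has_derivative D) (at X within sl2)"
    by (intro has_derivative_transform[OF assms(2), of F H]) (simp_all add: assms(1))
  ultimately show ?thesis unfolding sl2_differentiable_def by blast
qed

lemma sl2_differentiable_matrix_exp:
  fixes M :: "'a::comm_complex_banach_algebra^2^2"
  assumes "X \<in> sl2"
  shows "sl2_differentiable scaleC (\<lambda>X. (M ** matrix_exp X) $ i $ j) X"
proof (rule sl2_differentiable_cong[OF _ assms])
  \<comment> \<open>On \<open>sl2\<close> this is \<open>- det X\<close>, written with sums and
    products only so that the closure rules above apply; likewise the diagonal case distinction in
    \<open>?E\<close> becomes a constant factor.\<close>
  let ?d = "\<lambda>X :: 'a^2^2. X $ 1 $ 1 * X $ 1 $ 1 + X $ 1 $ 2 * X $ 2 $ 1"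
  let ?E = "\<lambda>X k. (if k = j then 1 else 0) * power_series cosh_coeffs (?d X) +
      power_series sinh_coeffs (?d X) * X $ k $ j"
  show "(M ** matrix_exp X) $ i $ j = M $ i $ 1 * ?E X 1 + M $ i $ 2 * ?E X 2" if "X \<in> sl2" for X
  proof -
    have "- det X = ?d X" using that by (simp add: det_2 sl2_trace)
    then show ?thesis by (simp add: matrix_mult_2 matrix_exp_sl2[OF that])
  qed
  show "sl2_differentiable scaleC (\<lambda>X. M $ i $ 1 * ?E X 1 + M $ i $ 2 * ?E X 2) X"
    by (intro sl2_differentiable_add sl2_differentiable_mult sl2_differentiable_const
        sl2_differentiable_power_series entire_cosh_coeffs entire_sinh_coeffs sl2_differentiable_entry)
qed

section \<open>The section attached to a derivation\<close>

text \<open>Where the first column \<open>(x, y)\<close> of \<open>q g\<close> has invertible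
  \<open>x\<close>, this is \<open>\<eta>(x)^2 D(y/x)\<close>: the derivation of an affine
  coordinate, with denominators cleared.\<close>

definition derivation_section ::
  "('a::comm_complex_banach_algebra \<Rightarrow> complex) \<Rightarrow> ('g \<Rightarrow> 'a^2^2) \<Rightarrow> ('a \<Rightarrow> complex) \<Rightarrow> 'g \<Rightarrow> complex" where
  "derivation_section \<eta> q D g = \<eta> (q g $ 1 $ 1) * D (q g $ 2 $ 1) - \<eta> (q g $ 2 $ 1) * D (q g $ 1 $ 1)"

lemma derivation_section_holomorphic:
  assumes \<eta>: "banach_character \<eta>" and D: "point_derivation \<eta> D"
    and cover: "simply_connected_covering_group G q SL2_0"
  shows "derivation_section \<eta> q D \<in> holomorphic_sections G q (pullback_xi_squared \<eta> q)"
proof -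
  note mult = cover_mult[OF cover]
  have \<eta>D: "bounded_linear \<eta>" "\<eta> (c *\<^sub>C x) = c * \<eta> x" "bounded_linear D" "D (c *\<^sub>C x) = c * D x"
    "\<eta> (x * y) = \<eta> x * \<eta> y" "D (x * y) = \<eta> x * D y + \<eta> y * D x" for c x y
    using \<eta> D banach_character_bounded_linear[OF \<eta>] by (auto simp: banach_character_def point_derivation_def)
  have "complex_differentiable_sl2 (\<lambda>X. derivation_section \<eta> q D (g \<otimes>\<^bsub>G\<^esub> cover_exp G q X)) X"
    if X: "X \<in> sl2" for g X
    unfolding complex_differentiable_sl2_iff
  proof (rule sl2_differentiable_cong[OF _ X])
    let ?M = "\<lambda>X. q g ** matrix_exp X"
    show "derivation_section \<eta> q D (g \<otimes>\<^bsub>G\<^esub> cover_exp G q X) =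
        \<eta> (?M X $ 1 $ 1) * D (?M X $ 2 $ 1) - \<eta> (?M X $ 2 $ 1) * D (?M X $ 1 $ 1)" if "X \<in> sl2" for X
      by (simp add: derivation_section_def mult cover_cover_exp[OF cover that])
    show "sl2_differentiable (*)
        (\<lambda>X. \<eta> (?M X $ 1 $ 1) * D (?M X $ 2 $ 1) - \<eta> (?M X $ 2 $ 1) * D (?M X $ 1 $ 1)) X"
      by (intro sl2_differentiable_complex_diff sl2_differentiable_complex_mult
          sl2_differentiable_functional[OF \<eta>D(1,2)] sl2_differentiable_functional[OF \<eta>D(3,4)]
          sl2_differentiable_matrix_exp X)
  qed
  \<comment> \<open>Differentiability holds at every point of \<open>sl2\<close>, so the radius 1 is
    arbitrary.\<close>
  then have "holomorphic_on_group G q (derivation_section \<eta> q D)"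
    unfolding holomorphic_on_group_def by (intro ballI exI[of _ 1]) auto
  moreover have "derivation_section \<eta> q D (g \<otimes>\<^bsub>G\<^esub> p) =
      inverse (pullback_xi_squared \<eta> q p) * derivation_section \<eta> q D g" if p: "p \<in> parabolic G q" for g p
  proof -
    have "(q g ** q p) $ i $ 1 = q g $ i $ 1 * q p $ 1 $ 1" for i
      by (simp add: matrix_mult_2 parabolic_upper_triangular[OF cover p])
    then show ?thesis
      by (simp add: derivation_section_def mult \<eta>D(5,6) pullback_xi_squared_def xi_def phi_G_def
          power2_eq_square algebra_simps)
  qed
  ultimately show ?thesis by (simp add: holomorphic_sections_def)
qed

text \<open>The matrix has determinant 0, so both series reduce to their constant term 1 and its
  exponential has first column \<open>(1, b)\<close>. The remaining term contains
  \<open>D 1\<close>, which the Leibniz rule makes 0.\<close>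

lemma derivation_section_cover_exp:
  assumes \<eta>: "banach_character \<eta>" and D: "point_derivation \<eta> D"
    and cover: "simply_connected_covering_group G q SL2_0"
  shows "derivation_section \<eta> q D (cover_exp G q (\<chi> i j. if i = 2 \<and> j = 1 then b else 0)) = D b"
proof -
  let ?X = "(\<chi> i j. if i = 2 \<and> j = 1 then b else 0) :: 'a^2^2"
  have X: "?X \<in> sl2" by (simp add: sl2_trace)
  have "\<eta> 1 = 1" and "D (1 * 1) = \<eta> 1 * D 1 + \<eta> 1 * D 1"
    using \<eta> D unfolding banach_character_def point_derivation_def by blast+
  then have "D 1 = 0" by simp
  then show ?thesis
    using \<open>\<eta> 1 = 1\<close> by (simp add: derivation_section_def cover_cover_exp[OF cover X] matrix_exp_sl2[OF X] det_2
        power_series_at_0 cosh_coeffs_def sinh_coeffs_def)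
qed

theorem proposition7p5:
  fixes \<eta> :: "'a::comm_complex_banach_algebra \<Rightarrow> complex"
    and G :: "'g::topological_space monoid"
    and q :: "'g \<Rightarrow> 'a^2^2"
  assumes "banach_character \<eta>"
    and "\<not> finite_dim_quotient (character_kernel \<eta>) (closed_square (character_kernel \<eta>))"
    and "simply_connected_covering_group G q SL2_0"
  shows "\<not> finite_dim_function_space (holomorphic_sections G q (pullback_xi_squared \<eta> q))"
proof
  note \<eta> = assms(1) and cover = assms(3)
  let ?s = "derivation_section \<eta> q" and ?Der = "{D. point_derivation \<eta> D}"
  assume "finite_dim_function_space (holomorphic_sections G q (pullback_xi_squared \<eta> q))"
  then obtain B where B: "finite B" "holomorphic_sections G q (pullback_xi_squared \<eta> q) \<subseteq> fun_cspan B"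
    unfolding finite_dim_function_space_def by blast
  have s_span: "?s ` ?Der \<subseteq> fun_cspan B"
    using derivation_section_holomorphic[OF \<eta> _ cover] B(2) by blast
  \<comment> \<open>\<open>B\<close> need not consist of derivation sections. A maximal independent
    set of such sections does, and it is finite because it lies in the span of
    \<open>B\<close>.\<close>
  obtain T where T: "T \<subseteq> ?s ` ?Der" "complex_functions.independent T" "?s ` ?Der \<subseteq> fun_cspan T"
    by (rule complex_functions.maximal_independent_subset)
  have "finite T"
    using complex_functions.independent_span_bound[OF B(1) T(2)] T(1) s_span by blast
  then obtain F where F: "finite F" "F \<subseteq> ?Der" "T = ?s ` F"
    using T(1) finite_subset_image by metis
  have "finite_dim_quotient (character_kernel \<eta>) (closed_square (character_kernel \<eta>))"
  proof (rule finite_dim_quotient_if_finite_separating[OF complex_subspace_character_kernel[OF \<eta>]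
        complex_subspace_closed_square F(1)])
    show "(\<forall>x y. D (x - y) = D x - D y) \<and> (\<forall>c x. D (c *\<^sub>C x) = c * D x)" if "D \<in> F" for D
      using that F(2) by (auto simp: point_derivation_def bounded_linear.linear linear_diff)
    fix b assume b: "b \<in> character_kernel \<eta>" and zero: "\<And>D. D \<in> F \<Longrightarrow> D b = 0"
    show "b \<in> closed_square (character_kernel \<eta>)"
    proof (rule ccontr)
      assume "b \<notin> closed_square (character_kernel \<eta>)"
      with b obtain D where D: "point_derivation \<eta> D" "D b \<noteq> 0"
        using point_derivation_separates[OF \<eta>] by (auto simp: character_kernel_def)
      \<comment> \<open>A point at which every derivation section takes the value of its derivation
        at \<open>b\<close>.\<close>
      define g where "g = cover_exp G q (\<chi> i j. if i = 2 \<and> j = 1 then b else 0)"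
      have s_g: "?s E g = E b" if "point_derivation \<eta> E" for E
        unfolding g_def by (rule derivation_section_cover_exp[OF \<eta> that cover])
      \<comment> \<open>Vanishing at \<open>g\<close> is a linear condition. It holds on
        \<open>T\<close> since all derivations in \<open>F\<close> vanish at \<open>b\<close>, hence
        for every derivation section, including that of \<open>D\<close>, contrary to
        \<open>D b \<noteq> 0\<close>.\<close>
      have "complex_functions.subspace {f :: 'g \<Rightarrow> complex. f g = 0}"
        by (auto simp: complex_functions.subspace_def)
      moreover have "T \<subseteq> {f. f g = 0}" using F(2,3) s_g zero by auto
      ultimately have "fun_cspan T \<subseteq> {f. f g = 0}" by (intro complex_functions.span_minimal)
      then have "?s D g = 0" using T(3) D(1) by blast
      with s_g[OF D(1)] D(2) show False by simp
    qed
  qed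
  with assms(2) show False ..
qed

end
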